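(* Let $d\in\mathbb N$, $d\ge2$. For every $\epsilon\in[0,\frac12]$ and $\delta\in[0,\frac12]$ and for almost every $x\in\mathbb R^d$, $$\lim_{s\nearrow1}\,(-\Delta_{\mathbb A_{s,\epsilon}})^su_\delta(x)=(-\Delta_{\mathbb A_\epsilon})u_\delta(x),$$ where $u_\delta(x)=|x|^{1-\delta}\frac{x_1}{|x|}$, and $s$ ranges over $(0,1)$.
   Context: For $x\in\mathbb R^d\setminus\{0\}$ write $\widehat x=x/|x|$, $(\widehat x\otimes\widehat x)_{ij}=\widehat x_i\widehat x_j$. For $s\in(0,1)$ define $$\mathbb A_{s,\epsilon}(x)=\left(1-\tfrac{1+2s}{2}\epsilon\right)\mathrm{Id}+\tfrac{d+2s}{2}\epsilon\,\widehat x\otimes\widehat x,\qquad \mathbb A_\epsilon(x)=(1-\epsilon)\mathrm{Id}+\epsilon\,\widehat x\otimes\widehat x,$$ $$\kappa_{d,s}=\frac{2^{2s-1}\Gamma(\frac d2+s)}{\pi^{d/2}|\Gamma(-s)|},\qquad k_{s,\epsilon}(x,y)=|x-y|^{-d-2s}\left\langle\tfrac{\mathbb A_{s,\epsilon}(x)+\mathbb A_{s,\epsilon}(y)}{2}\,\widehat{x-y},\widehat{x-y}\right\rangle .$$ For $x\ne0$, $$(-\Delta_{\mathbb A_{s,\epsilon}})^su_\delta(x)=2\kappa_{d,s}\lim_{R\to\infty}\int_{\frac1R\le|h|\le R}k_{s,\epsilon}(x,x+h)\,\bigl(u_\delta(x)-u_\delta(x+h)\bigr)\,dh ,$$ and $(-\Delta_{\mathbb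 A_\epsilon})u_\delta(x)=-\operatorname{div}\bigl(\mathbb A_\epsilon(x)\nabla u_\delta(x)\bigr)$, computed pointwise for $x\neq 0$. *)

theory Defs
  imports "HOL-Analysis.Analysis"
begin

definition unit_vec :: "real ^ 'n \<Rightarrow> real ^ 'n"
  where "unit_vec x = x /\<^sub>R norm x"

definition outer :: "real ^ 'n \<Rightarrow> real ^ 'n \<Rightarrow> real ^ 'n ^ 'n"
  where "outer v w = (\<chi> i j. v $ i * w $ j)"

definition A_nonlocal :: "real \<Rightarrow> real \<Rightarrow> real ^ 'n \<Rightarrow> real ^ 'n ^ 'n"
  where "A_nonlocal s \<epsilon> x =
    (1 - (1 + 2 * s) / 2 * \<epsilon>) *\<^sub>R mat 1
    + ((real CARD('n) + 2 * s) / 2 * \<epsilon>) *\<^sub>R outer (unit_vec x) (unit_vec x)"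

definition A_local :: "real \<Rightarrow> real ^ 'n \<Rightarrow> real ^ 'n ^ 'n"
  where "A_local \<epsilon> x = (1 - \<epsilon>) *\<^sub>R mat 1 + \<epsilon> *\<^sub>R outer (unit_vec x) (unit_vec x)"

definition kappa :: "nat \<Rightarrow> real \<Rightarrow> real"
  where "kappa d s =
    2 powr (2 * s - 1) * Gamma (real d / 2 + s) / (pi powr (real d / 2) * \<bar>Gamma (- s)\<bar>)"

definition kernel :: "real \<Rightarrow> real \<Rightarrow> real ^ 'n \<Rightarrow> real ^ 'n \<Rightarrow> real"
  where "kernel s \<epsilon> x y =
    norm (x - y) powr (- real CARD('n) - 2 * s)
    * ((((1 / 2) *\<^sub>R (A_nonlocal s \<epsilon> x + A_nonlocal s \<epsilon> y)) *v unit_vec (x - y)) \<bullet> unit_vec (x - y))"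

definition truncated_integral ::
    "real \<Rightarrow> real \<Rightarrow> (real ^ 'n \<Rightarrow> real) \<Rightarrow> real ^ 'n \<Rightarrow> real \<Rightarrow> real"
  where "truncated_integral s \<epsilon> u x R =
    (LINT h : {h. 1 / R \<le> norm h \<and> norm h \<le> R} | lborel.
      kernel s \<epsilon> x (x + h) * (u x - u (x + h)))"

text \<open>\<^const>\<open>Lim\<close> is unspecified when the limit does not exist, so existence of the limit
  has to be asserted separately where it matters.\<close>

definition frac_op :: "real \<Rightarrow> real \<Rightarrow> (real ^ 'n \<Rightarrow> real) \<Rightarrow> real ^ 'n \<Rightarrow> real"
  where "frac_op s \<epsilon> u x = 2 * kappa CARD('n) s * Lim at_top (truncated_integral s \<epsilon> u x)"

definition partial :: "'n \<Rightarrow> (real ^ 'n \<Rightarrow> real) \<Rightarrow> real ^ 'n \<Rightarrow> real"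
  where "partial i f x = deriv (\<lambda>t. f (x + t *\<^sub>R axis i 1)) 0"

definition grad :: "(real ^ 'n \<Rightarrow> real) \<Rightarrow> real ^ 'n \<Rightarrow> real ^ 'n"
  where "grad f x = (\<chi> i. partial i f x)"

definition divergence :: "(real ^ 'n \<Rightarrow> real ^ 'n) \<Rightarrow> real ^ 'n \<Rightarrow> real"
  where "divergence F x = (\<Sum>i\<in>UNIV. partial i (\<lambda>y. F y $ i) x)"

definition local_op :: "real \<Rightarrow> (real ^ 'n \<Rightarrow> real) \<Rightarrow> real ^ 'n \<Rightarrow> real"
  where "local_op \<epsilon> u x = - divergence (\<lambda>y. A_local \<epsilon> y *v grad u y) x"

text \<open>The index type carries no distinguished first coordinate; the argument \<open>e\<close> plays
  the role of the index \<open>1\<close>.\<close>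

definition u_fun :: "'n \<Rightarrow> real \<Rightarrow> real ^ 'n \<Rightarrow> real"
  where "u_fun e \<delta> x = norm x powr (1 - \<delta>) * (x $ e / norm x)"

end

theory Submission
  imports Defs "HOL-Library.Landau_Symbols"
begin

text \<open>
  Averaging the integrand over \<open>h\<close> and \<open>- h\<close> turns it into \<open>norm h powr (- n - 2 * s) * N h\<close> where
  \<open>N\<close> is bounded on the whole space: \<open>u\<close> is odd, which cancels its growth at infinity, and the
  direction of \<open>x + h\<close> differs from that of \<open>h\<close> by an angle of order \<open>1 / norm h\<close>. Near the origin \<open>N h\<close> equals
  \<open>(norm h)\<^sup>2 * F (h / norm h)\<close> up to a cubic error. Hence the integrals converge for every \<open>s\<close> in \<open>(0,1)\<close>. Since
  \<open>kappa n s\<close> vanishes like \<open>1 - s\<close>, only the quadratic part of \<open>N\<close> near the origin contributes to the limit,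
  which is \<open>n\<close> times the spherical mean of \<open>F\<close>. As \<open>F\<close> is a quartic polynomial, its mean follows from
  the second and fourth moments of the sphere, and it agrees with the divergence form operator.
\<close>

section \<open>Polar coordinates and orthogonal invariance\<close>

text \<open>The truncated integrals are principal values at both ends: in general, for s >= 1/2 the
  first order part of the difference is not absolutely integrable at the origin, and for 2 s <= 1 -
  delta the growth of u is not integrable at infinity. Reflections are therefore carried out at
  finite R, on a shell symmetric about 0, and only the symmetrized integrand is passed to the limit.
  The coefficients of \<open>A_nonlocal\<close> come from the spherical average. For symmetric B and
  H the mean of (Bw.w)(Hw.w) over the unit sphere is (tr B tr H + 2 tr(BH)) / (n(n+2)). If B is a Id
  plus b times the projection onto a unit vector v, then n times this mean is (a + b/(n+2)) tr H +
  2b/(n+2) Hv.v. Asking for (1 - eps) tr H + eps Hv.v forces b = (n+2) eps/2 and a = 1 - 3 eps/2,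
  the values at s = 1. The first order terms of the divergence form operator come from the variation
  of the matrix between x and x + h: its linear part is odd in h, as is that of u, so their product
  survives symmetrization.\<close>

lemma unit_vec_scaleR: "c > 0 \<Longrightarrow> unit_vec (c *\<^sub>R x) = unit_vec x"
  by (simp add: unit_vec_def)

lemma norm_unit_vec_le: "norm (unit_vec x) \<le> 1"
  by (cases "x = 0") (simp_all add: unit_vec_def)

lemma unit_vec_measurable [measurable]: "unit_vec \<in> borel_measurable borel"
  unfolding unit_vec_def[abs_def] by measurable

lemma AE_lborel_neq: "AE h in lborel. h \<noteq> (c :: 'a :: euclidean_space)"
  by (rule AE_I[of _ _ "{c}"]) auto

text \<open>\<open>F (unit_vec h)\<close> is constant along rays, so a dilation affects only
  Lebesgue measure, through the factor \<open>a ^ CARD('n)\<close>.\<close>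

lemma nn_integral_cball_scale:
  fixes F :: "real ^ 'n \<Rightarrow> ennreal"
  assumes [measurable]: "F \<in> borel_measurable borel" and a: "a > 0"
  shows "(\<integral>\<^sup>+h. F (unit_vec h) * indicator (cball 0 a) h \<partial>lborel) =
    ennreal (a ^ CARD('n)) * (\<integral>\<^sup>+h. F (unit_vec h) * indicator (cball 0 1) h \<partial>lborel)"
proof -
  have m: "(\<lambda>h. F (unit_vec h) * indicator (cball 0 a) h) \<in> borel_measurable borel" for a
    by (intro borel_measurable_times_ennreal borel_measurable_indicator; measurable; simp)
  have "(\<integral>\<^sup>+h. F (unit_vec h) * indicator (cball 0 a) h \<partial>lborel) =
    (\<integral>\<^sup>+h. F (unit_vec h) * indicator (cball 0 a) h
      \<partial>density (distr lborel borel (\<lambda>x. 0 + a *\<^sub>R x)) (\<lambda>_. \<bar>a\<bar> ^ DIM(real ^ 'n)))"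
    using lborel_affine[of a "0 :: real ^ 'n"] a by simp
  also have "\<dots> = (\<integral>\<^sup>+h. ennreal (a ^ CARD('n)) *
      (F (unit_vec (a *\<^sub>R h)) * indicator (cball 0 a) (a *\<^sub>R h)) \<partial>lborel)"
    using a m[of a] by (simp add: nn_integral_density nn_integral_distr)
  also have "\<dots> = (\<integral>\<^sup>+h. ennreal (a ^ CARD('n)) * (F (unit_vec h) * indicator (cball 0 1) h) \<partial>lborel)"
    using a by (intro nn_integral_cong) (auto simp: unit_vec_scaleR indicator_def)
  finally show ?thesis using m[of 1] by (simp add: nn_integral_cmult)
qed

lemma nn_integral_power_Ioc:
  assumes "a > 0" "d > 0"
  shows "(\<integral>\<^sup>+t. ennreal (real d * t ^ (d - 1)) * indicator {0<..a} t \<partial>lborel) = ennreal (a ^ d)"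
proof -
  have "(\<integral>\<^sup>+t. ennreal (real d * t ^ (d - 1)) * indicator {0<..a} t \<partial>lborel)
      = (\<integral>\<^sup>+t. ennreal (real d * t ^ (d - 1)) * indicator {0..a} t \<partial>lborel)"
    by (rule nn_integral_cong_AE, use AE_lborel_neq[of "0::real"] in eventually_elim)
       (auto simp: indicator_def)
  also have "\<dots> = ennreal (a ^ d - 0 ^ d)"
    using assms by (intro nn_integral_FTC_Icc) (auto intro!: derivative_eq_intros)
  finally show ?thesis using assms by simp
qed

text \<open>Both sides are integrals of \<open>g\<close> against measures on the line; they agree on
  half-lines by scaling.\<close>

lemma nn_integral_polar:
  fixes F :: "real ^ 'n \<Rightarrow> real" and g :: "real \<Rightarrow> ennreal"
  assumes [measurable]: "F \<in> borel_measurable borel" "g \<in> borel_measurable borel"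
    and c: "(\<integral>\<^sup>+h. ennreal (F (unit_vec h)) * indicator (cball 0 1) h \<partial>lborel) = ennreal c" "c \<ge> 0"
  shows "(\<integral>\<^sup>+h. ennreal (F (unit_vec h)) * g (norm h) \<partial>lborel) =
    ennreal c * (\<integral>\<^sup>+t. g t * (ennreal (real CARD('n) * t ^ (CARD('n) - 1)) * indicator {0<..} t) \<partial>lborel)"
proof -
  let ?d = "CARD('n)"
  let ?M = "distr (density lborel (\<lambda>h. ennreal (F (unit_vec h)))) borel (norm :: real^'n \<Rightarrow> real)"
  let ?w = "\<lambda>t. ennreal c * (ennreal (real ?d * t ^ (?d - 1)) * indicator {0<..} t)"
  let ?N = "density lborel ?w"
  have pos: "CARD('n) > 0" by simp
  have eq: "emeasure ?M {..a} = emeasure ?N {..a}" and fin: "emeasure ?M {..a} \<noteq> \<infinity>" for a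
  proof -
    have 1: "emeasure ?M {..a} = (\<integral>\<^sup>+h. ennreal (F (unit_vec h)) * indicator (cball 0 a) h \<partial>lborel)"
    proof -
      have "norm -` {..a} = (cball 0 a :: (real ^ 'n) set)" by auto
      then show ?thesis by (simp add: emeasure_distr emeasure_density)
    qed
    have 2: "emeasure ?N {..a} = ennreal c *
        (\<integral>\<^sup>+t. ennreal (real ?d * t ^ (?d - 1)) * indicator {0<..a} t \<partial>lborel)"
      by (subst emeasure_density, simp, simp, subst nn_integral_cmult[symmetric], simp)
         (auto simp: indicator_def intro!: nn_integral_cong)
    have "emeasure ?M {..a} = ennreal (if a > 0 then a ^ ?d * c else 0)"
    proof (cases "a > 0")
      case True
      then show ?thesis
        unfolding 1 by (subst nn_integral_cball_scale[where F = "\<lambda>h. ennreal (F h)"]) (use c in \<open>simp_all add: ennreal_mult\<close>)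
    next
      \<comment> \<open>For \<open>a = 0\<close> the ball is the single point 0, where
        \<open>F (unit_vec 0) = F 0\<close> may be nonzero; it is discarded as a null set.\<close>
      case False
      have "(\<integral>\<^sup>+h. ennreal (F (unit_vec h)) * indicator (cball 0 a) h \<partial>lborel) = (\<integral>\<^sup>+(h::real^'n). 0 \<partial>lborel)"
        by (rule nn_integral_cong_AE, use AE_lborel_neq[of "0::real^'n"] in eventually_elim)
           (use False in \<open>auto simp: indicator_def not_less dest: order_trans\<close>)
      then show ?thesis using False unfolding 1 by simp
    qed
    moreover have "emeasure ?N {..a} = ennreal (if a > 0 then a ^ ?d * c else 0)"
    proof (cases "a > 0")
      case True
      then show ?thesis
        unfolding 2 using c nn_integral_power_Ioc[OF True pos] by (simp add: ennreal_mult mult.commute)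
    qed (unfold 2, simp)
    ultimately show "emeasure ?M {..a} = emeasure ?N {..a}" "emeasure ?M {..a} \<noteq> \<infinity>"
      by simp_all
  qed
  have "?M = ?N"
  proof (rule measure_eqI_generator_eq[where \<Omega> = UNIV and E = "range atMost" and A = "\<lambda>n. {..real n}"])
    show "Int_stable (range (atMost :: real \<Rightarrow> _))"
      by (auto simp: Int_stable_def)
    show "(\<Union>i. {..real i}) = UNIV"
      by (auto intro: real_arch_simple)
  qed (use eq fin in \<open>auto simp: borel_eq_atMost\<close>)
  then have "(\<integral>\<^sup>+t. g t \<partial>?M) = (\<integral>\<^sup>+t. g t \<partial>?N)" by simp
  then have "(\<integral>\<^sup>+h. ennreal (F (unit_vec h)) * g (norm h) \<partial>lborel) = (\<integral>\<^sup>+t. ?w t * g t \<partial>lborel)"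
    by (simp add: nn_integral_distr nn_integral_density)
  then show ?thesis
    by (simp add: nn_integral_cmult[symmetric] mult_ac)
qed

lemma nn_integral_lborel_translate:
  fixes g :: "'a :: euclidean_space \<Rightarrow> ennreal"
  assumes [measurable]: "g \<in> borel_measurable borel"
  shows "(\<integral>\<^sup>+x. g (c + x) \<partial>lborel) = (\<integral>\<^sup>+x. g x \<partial>lborel)"
  by (subst (2) lborel_distr_plus[of c, symmetric]) (simp add: nn_integral_distr)

lemma borel_measurable_orthogonal:
  fixes f :: "real ^ 'n \<Rightarrow> real ^ 'n"
  assumes "orthogonal_transformation f"
  shows "f \<in> borel_measurable borel"
proof -
  have "bounded_linear f"
    using assms by (simp add: orthogonal_transformation linear_conv_bounded_linear[symmetric])
  then show ?thesis
    using linear_continuous_on borel_measurable_continuous_onI by blast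
qed

text \<open>Uniqueness of Haar measure, in the form of a Fubini argument against the indicator
  of a ball. The library's determinant formula is available only for well-ordered index types.\<close>

lemma nn_integral_orthogonal:
  fixes f :: "real ^ 'n \<Rightarrow> real ^ 'n" and g :: "real ^ 'n \<Rightarrow> ennreal"
  assumes f: "orthogonal_transformation f" and [measurable]: "g \<in> borel_measurable borel"
  shows "(\<integral>\<^sup>+x. g (f x) \<partial>lborel) = (\<integral>\<^sup>+x. g x \<partial>lborel)"
proof -
  let ?K = "cball 0 1 :: (real ^ 'n) set"
  let ?k = "indicator ?K :: _ \<Rightarrow> ennreal"
  have [measurable]: "?K \<in> sets borel" by simp
  have lin: "linear f" and nrm: "norm (f v) = norm v" for v
    using f by (auto simp: orthogonal_transformation)
  have [measurable]: "f \<in> borel_measurable borel"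
    by (rule borel_measurable_orthogonal[OF f])
  have surj: "\<exists>x'. x = f x'" for x
    using orthogonal_transformation_surj[OF f] by (metis surjD)
  have ball: "(\<integral>\<^sup>+x. ?k x \<partial>lborel) = emeasure lborel ?K"
    by simp
  have ne0: "emeasure lborel ?K \<noteq> 0" "emeasure lborel ?K \<noteq> \<infinity>"
    by (simp_all add: emeasure_cball unit_ball_vol_def Gamma_real_pos[THEN less_imp_neq, symmetric])
  have in1: "(\<integral>\<^sup>+y. g (f y + x) \<partial>lborel) = (\<integral>\<^sup>+y. g (f y) \<partial>lborel)" for x
  proof -
    obtain x' where "x = f x'" using surj by blast
    then have "g (f y + x) = g (f (x' + y))" for y
      by (simp add: linear_add[OF lin] add.commute)
    then show ?thesis using nn_integral_lborel_translate[of "\<lambda>y. g (f y)" x'] by simp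
  qed
  have in2: "(\<integral>\<^sup>+x. ?k x * g (f y + x) \<partial>lborel) = (\<integral>\<^sup>+x. ?k (x - f y) * g x \<partial>lborel)" for y
    using nn_integral_lborel_translate[of "\<lambda>x. ?k (x - f y) * g x" "f y"] by simp
  have in3: "(\<integral>\<^sup>+y. ?k (x - f y) \<partial>lborel) = emeasure lborel ?K" for x
  proof -
    obtain x' where x': "x = f x'" using surj by blast
    have "norm (x - f y) = norm (x' - y)" for y
      unfolding x' by (simp add: nrm flip: linear_diff[OF lin])
    then have "?k (x - f y) = indicator (cball x' 1) y" for y
      by (simp only: indicator_def mem_cball dist_norm diff_zero zero_diff diff_0 norm_minus_cancel)
    then show ?thesis by (simp add: emeasure_cball)
  qed
  \<comment> \<open>Translating y by a preimage of x makes the inner integral independent of x.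
    After the exchange of integrals, translating x by \<open>f y\<close> moves the dependence on y
    into the ball, whose preimage under the isometry f is again a unit ball. The ball has positive
    finite measure, so it cancels.\<close>
  have "emeasure lborel ?K * (\<integral>\<^sup>+y. g (f y) \<partial>lborel)
      = (\<integral>\<^sup>+x. \<integral>\<^sup>+y. ?k x * g (f y + x) \<partial>lborel \<partial>lborel)"
    unfolding ball[symmetric] by (simp add: nn_integral_multc nn_integral_cmult in1)
  also have "\<dots> = (\<integral>\<^sup>+y. \<integral>\<^sup>+x. ?k x * g (f y + x) \<partial>lborel \<partial>lborel)"
    by (rule lborel_pair.Fubini'[symmetric]) measurable
  also have "\<dots> = (\<integral>\<^sup>+x. \<integral>\<^sup>+y. ?k (x - f y) * g x \<partial>lborel \<partial>lborel)"
    unfolding in2 by (rule lborel_pair.Fubini') measurable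
  also have "\<dots> = emeasure lborel ?K * (\<integral>\<^sup>+x. g x \<partial>lborel)"
    by (simp add: nn_integral_multc nn_integral_cmult in3)
  finally show ?thesis
    using ne0 by (simp add: ennreal_mult_cancel_left)
qed

section \<open>Moments of the sphere\<close>

text \<open>The surface integral of F over the unit sphere divided by n, written as a solid integral
  so that no surface measure has to be constructed. Its total mass is the volume of the unit ball,
  and the missing factor n reappears in the radial integrals below.\<close>

definition sphere_moment :: "(real ^ 'n \<Rightarrow> real) \<Rightarrow> real"
  where "sphere_moment F = (LINT h : cball 0 1 | lborel. F (unit_vec h))"

lemma continuous_unit_vec_bounded:
  fixes F :: "real ^ 'n \<Rightarrow> real"
  assumes "continuous_on UNIV F"
  obtains C where "C \<ge> 0" "\<And>h. \<bar>F (unit_vec h)\<bar> \<le> C"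
proof -
  \<comment> \<open>The closed ball and not the sphere, because
    \<open>unit_vec 0 = 0\<close>.\<close>
  have "compact (F ` cball 0 1)"
    using assms by (intro compact_continuous_image continuous_on_subset[OF assms]) auto
  then have "bounded (F ` cball 0 1)" by (rule compact_imp_bounded)
  then obtain C where C: "\<And>y. y \<in> cball 0 1 \<Longrightarrow> norm (F y) \<le> C"
    unfolding bounded_iff by blast
  show ?thesis
  proof (rule that[of C])
    show "C \<ge> 0" using C[of 0] by (auto intro: order_trans[OF abs_ge_zero])
    show "\<bar>F (unit_vec h)\<bar> \<le> C" for h using C[of "unit_vec h"] by (simp add: norm_unit_vec_le)
  qed
qed

lemma sphere_moment_integrable:
  fixes F :: "real ^ 'n \<Rightarrow> real"
  assumes "continuous_on UNIV F"
  shows "set_integrable lborel (cball 0 1) (\<lambda>h. F (unit_vec h))"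
proof -
  have [measurable]: "F \<in> borel_measurable borel" "cball 0 1 \<in> sets (borel :: (real ^ 'n) measure)"
    using assms by (auto intro: borel_measurable_continuous_onI)
  obtain C where "\<And>h. \<bar>F (unit_vec h)\<bar> \<le> C"
    using continuous_unit_vec_bounded[OF assms] by blast
  then show ?thesis
    unfolding set_integrable_def
    by (intro integrableI_bounded_set[where A = "cball 0 1" and B = C])
       (auto simp: emeasure_cball indicator_def)
qed

lemma sphere_moment_add:
  assumes "continuous_on UNIV F" "continuous_on UNIV G"
  shows "sphere_moment (\<lambda>w. F w + G w) = sphere_moment F + sphere_moment G"
  unfolding sphere_moment_def
  by (rule set_integral_add(2)) (rule sphere_moment_integrable, fact)+

lemma sphere_moment_cmult: "sphere_moment (\<lambda>w. c * F w) = c * sphere_moment F"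
  unfolding sphere_moment_def by simp

lemma sphere_moment_sum:
  assumes "\<And>i. i \<in> I \<Longrightarrow> continuous_on UNIV (F i)"
  shows "sphere_moment (\<lambda>w. \<Sum>i\<in>I. F i w) = (\<Sum>i\<in>I. sphere_moment (F i))"
  using assms
proof (induction I rule: infinite_finite_induct)
  case (insert i I)
  then show ?case
    by (simp add: sphere_moment_add continuous_on_sum)
qed (simp_all add: sphere_moment_def)

lemma distr_lborel_orthogonal:
  fixes f :: "real ^ 'n \<Rightarrow> real ^ 'n"
  assumes f: "orthogonal_transformation f"
  shows "distr lborel borel f = lborel"
proof (rule measure_eqI)
  have [measurable]: "f \<in> borel_measurable borel"
    by (rule borel_measurable_orthogonal[OF f])
  fix A assume "A \<in> sets (distr lborel borel f)"
  then have [measurable]: "A \<in> sets borel" by simp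
  have "emeasure (distr lborel borel f) A = (\<integral>\<^sup>+x. indicator A x \<partial>distr lborel borel f)"
    by simp
  also have "\<dots> = (\<integral>\<^sup>+x. indicator A (f x) \<partial>lborel)"
    by (rule nn_integral_distr) measurable
  also have "\<dots> = emeasure lborel A"
    by (subst nn_integral_orthogonal[OF f]) simp_all
  finally show "emeasure (distr lborel borel f) A = emeasure lborel A" .
qed simp

lemma sphere_moment_orthogonal:
  fixes f :: "real ^ 'n \<Rightarrow> real ^ 'n"
  assumes f: "orthogonal_transformation f" and F: "continuous_on UNIV F"
  shows "sphere_moment (\<lambda>w. F (f w)) = sphere_moment F"
proof -
  have [measurable]: "F \<in> borel_measurable borel" "cball 0 1 \<in> sets (borel :: (real ^ 'n) measure)"
    using F by (auto intro: borel_measurable_continuous_onI)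
  have [measurable]: "f \<in> borel_measurable borel"
    by (rule borel_measurable_orthogonal[OF f])
  have lin: "linear f" and nrm: "norm (f v) = norm v" for v
    using f by (auto simp: orthogonal_transformation)
  have "sphere_moment F = (LINT h : cball 0 1 | distr lborel borel f. F (unit_vec h))"
    unfolding sphere_moment_def distr_lborel_orthogonal[OF f] ..
  also have "\<dots> = (LINT h|lborel. indicator (cball 0 1) (f h) *\<^sub>R F (unit_vec (f h)))"
    unfolding set_lebesgue_integral_def by (subst integral_distr) simp_all
  also have "\<dots> = sphere_moment (\<lambda>w. F (f w))"
    unfolding sphere_moment_def set_lebesgue_integral_def
    by (simp add: indicator_def nrm unit_vec_def linear_scale[OF lin])
  finally show ?thesis ..
qed

text \<open>A rotation carries \<open>norm v *\<^sub>R b\<close> to v, so the moments of powers of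
  linear forms are known up to one constant for each degree k.\<close>

lemma sphere_moment_inner_power:
  fixes b v :: "real ^ 'n"
  assumes "norm b = 1"
  shows "sphere_moment (\<lambda>w. (w \<bullet> v) ^ k) = norm v ^ k * sphere_moment (\<lambda>w. (w \<bullet> b) ^ k)"
proof -
  obtain f where f: "orthogonal_transformation f" "f (norm v *\<^sub>R b) = v"
    using orthogonal_transformation_exists[of "norm v *\<^sub>R b" v] assms by auto
  have eq: "f w \<bullet> v = norm v * (w \<bullet> b)" for w
  proof -
    have "f w \<bullet> f (norm v *\<^sub>R b) = w \<bullet> (norm v *\<^sub>R b)"
      using f(1) unfolding orthogonal_transformation_def by blast
    then show ?thesis by (simp add: f(2))
  qed
  have "sphere_moment (\<lambda>w. (w \<bullet> v) ^ k) = sphere_moment (\<lambda>w. (f w \<bullet> v) ^ k)"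
    by (rule sphere_moment_orthogonal[OF f(1), symmetric]) (intro continuous_intros)
  then show ?thesis by (simp add: eq sphere_moment_cmult power_mult_distrib)
qed

text \<open>Directions satisfy w.w = 1 except at the origin, a null set. This is what relates
  moments of different degrees.\<close>

lemma sphere_moment_norm_mult:
  fixes F :: "real ^ 'n \<Rightarrow> real"
  assumes F: "continuous_on UNIV F"
  shows "sphere_moment (\<lambda>w. F w * (w \<bullet> w)) = sphere_moment F"
proof -
  have [measurable]: "F \<in> borel_measurable borel" "cball 0 1 \<in> sets (borel :: (real ^ 'n) measure)"
    using F by (auto intro: borel_measurable_continuous_onI)
  show ?thesis
    unfolding sphere_moment_def set_lebesgue_integral_def
  proof (rule Bochner_Integration.integral_cong_AE)
    show "AE h in lborel. indicat_real (cball 0 1) h *\<^sub>R (F (unit_vec h) * (unit_vec h \<bullet> unit_vec h)) =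
      indicat_real (cball 0 1) h *\<^sub>R F (unit_vec h)"
      using AE_lborel_neq[of "0 :: real ^ 'n"]
      by eventually_elim (simp add: unit_vec_def dot_square_norm power2_eq_square)
  qed measurable
qed

lemma sphere_moment_one: "sphere_moment (\<lambda>w :: real ^ 'n. 1) = unit_ball_vol CARD('n)"
  by (simp add: sphere_moment_def set_lebesgue_integral_def content_cball)

lemma inner_self_sum: "w \<bullet> w = (\<Sum>i\<in>UNIV. (w \<bullet> axis i 1)\<^sup>2)" for w :: "real ^ 'n"
  by (simp add: inner_axis power2_eq_square) (simp add: inner_vec_def)

text \<open>All axes have the same second moment by rotation, and over the n axes these moments add
  up to the moment of w.w = 1.\<close>

lemma sphere_moment_2:
  fixes v :: "real ^ 'n"
  shows "sphere_moment (\<lambda>w. (w \<bullet> v)\<^sup>2) = unit_ball_vol CARD('n) / CARD('n) * (norm v)\<^sup>2"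
proof -
  fix k :: 'n
  define m where "m = sphere_moment (\<lambda>w. (w \<bullet> axis k (1::real))\<^sup>2)"
  have eq: "sphere_moment (\<lambda>w. (w \<bullet> v)\<^sup>2) = (norm v)\<^sup>2 * m" for v :: "real ^ 'n"
    unfolding m_def by (rule sphere_moment_inner_power) simp
  have "unit_ball_vol CARD('n) = sphere_moment (\<lambda>w :: real ^ 'n. w \<bullet> w)"
    using sphere_moment_norm_mult[of "\<lambda>w :: real ^ 'n. 1"] by (simp add: sphere_moment_one)
  also have "\<dots> = (\<Sum>i\<in>UNIV. sphere_moment (\<lambda>w :: real ^ 'n. (w \<bullet> axis i 1)\<^sup>2))"
    unfolding inner_self_sum by (rule sphere_moment_sum) (intro continuous_intros)
  also have "\<dots> = CARD('n) * m" by (simp add: eq)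
  finally show ?thesis using eq[of v] by simp
qed

lemma sphere_moment_11:
  fixes v u :: "real ^ 'n"
  shows "sphere_moment (\<lambda>w. (w \<bullet> v) * (w \<bullet> u)) = unit_ball_vol CARD('n) / CARD('n) * (v \<bullet> u)"
proof -
  have "(\<lambda>w. (w \<bullet> (v + u))\<^sup>2) =
      (\<lambda>w. (w \<bullet> v)\<^sup>2 + ((w \<bullet> u)\<^sup>2 + 2 * ((w \<bullet> v) * (w \<bullet> u))))"
    by (rule ext, unfold inner_add_right, algebra)
  from arg_cong[OF this, of sphere_moment] have "sphere_moment (\<lambda>w. (w \<bullet> (v + u))\<^sup>2) = sphere_moment (\<lambda>w. (w \<bullet> v)\<^sup>2)
      + (sphere_moment (\<lambda>w. (w \<bullet> u)\<^sup>2) + 2 * sphere_moment (\<lambda>w. (w \<bullet> v) * (w \<bullet> u)))"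
      by (simp add: sphere_moment_add sphere_moment_cmult continuous_on_add continuous_on_mult
        continuous_on_power continuous_on_inner continuous_on_const)
  then show ?thesis
    unfolding sphere_moment_2 by (simp add: power2_norm_eq_inner inner_simps inner_commute field_simps)
qed

text \<open>The fourth moment is a rotation invariant quartic form, so it is a multiple of \<open>norm v ^ 4\<close>;
  polarising and summing over an orthonormal basis reduces the constant to the second moment.\<close>

lemma sphere_moment_4:
  fixes v :: "real ^ 'n"
  shows "sphere_moment (\<lambda>w. (w \<bullet> v) ^ 4) =
    3 * unit_ball_vol CARD('n) / (CARD('n) * (CARD('n) + 2)) * norm v ^ 4"
proof -
  fix k :: 'n
  let ?M = "\<lambda>v :: real ^ 'n. sphere_moment (\<lambda>w. (w \<bullet> v) ^ 4)"
  let ?a = "\<lambda>i :: 'n. axis i (1::real)"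
  define m where "m = ?M (?a k)"
  have eq: "?M v = norm v ^ 4 * m" for v
    unfolding m_def by (rule sphere_moment_inner_power) simp
  \<comment> \<open>In the sum of the two fourth powers the odd mixed terms cancel. Both vectors
    have norm sqrt 2 and hence moment 4 m, so 8 m = 4 m + 12 times the mixed moment.\<close>
  have mixed: "sphere_moment (\<lambda>w. (w \<bullet> ?a k)\<^sup>2 * (w \<bullet> ?a i)\<^sup>2) = m / 3" if "i \<noteq> k" for i
  proof -
    have "(\<lambda>w. (w \<bullet> (?a k + ?a i)) ^ 4 + (w \<bullet> (?a k - ?a i)) ^ 4) =
        (\<lambda>w. 2 * (w \<bullet> ?a k) ^ 4 + (12 * ((w \<bullet> ?a k)\<^sup>2 * (w \<bullet> ?a i)\<^sup>2) + 2 * (w \<bullet> ?a i) ^ 4))"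
      by (rule ext, unfold inner_add_right inner_diff_right, algebra)
    from arg_cong[OF this, of sphere_moment] have "?M (?a k + ?a i) + ?M (?a k - ?a i) =
        2 * ?M (?a k) + (12 * sphere_moment (\<lambda>w. (w \<bullet> ?a k)\<^sup>2 * (w \<bullet> ?a i)\<^sup>2) + 2 * ?M (?a i))"
      by (simp add: sphere_moment_add sphere_moment_cmult continuous_on_add continuous_on_mult
        continuous_on_power continuous_on_inner continuous_on_const)
    moreover have "(norm (?a k + ?a i))\<^sup>2 = 2" "(norm (?a k - ?a i))\<^sup>2 = 2"
      using that by (simp_all add: power2_norm_eq_inner inner_simps inner_axis_axis)
    then have "norm (?a k + ?a i) ^ 4 = 4" "norm (?a k - ?a i) ^ 4 = 4"
      by (simp_all add: power4_eq_xxxx power2_eq_square)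
    ultimately show ?thesis by (simp add: eq)
  qed
  have "unit_ball_vol CARD('n) / CARD('n) = sphere_moment (\<lambda>w. (w \<bullet> ?a k)\<^sup>2)"
    by (simp add: sphere_moment_2)
  also have "\<dots> = sphere_moment (\<lambda>w. (w \<bullet> ?a k)\<^sup>2 * (w \<bullet> w))"
    by (rule sphere_moment_norm_mult[symmetric]) (intro continuous_intros)
  also have "\<dots> = (\<Sum>i\<in>UNIV. sphere_moment (\<lambda>w. (w \<bullet> ?a k)\<^sup>2 * (w \<bullet> ?a i)\<^sup>2))"
    unfolding inner_self_sum sum_distrib_left by (rule sphere_moment_sum) (intro continuous_intros)
  \<comment> \<open>The axis k itself contributes m and each of the n - 1 others m / 3, in total m
    (n + 2) / 3.\<close>
  also have "\<dots> = sphere_moment (\<lambda>w. (w \<bullet> ?a k)\<^sup>2 * (w \<bullet> ?a k)\<^sup>2) + (\<Sum>i\<in>UNIV - {k}. m / 3)"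
    by (subst sum.remove[of _ k], simp, simp, intro arg_cong2[where f = "(+)"] refl sum.cong mixed) simp
  also have "\<dots> = m + (real CARD('n) - 1) * (m / 3)"
    by (simp add: m_def power4_eq_xxxx power2_eq_square card_Diff_singleton of_nat_diff mult_ac)
  finally have "m * (CARD('n) + 2) / 3 = unit_ball_vol CARD('n) / CARD('n)"
    by (simp add: field_simps)
  moreover have "m = 3 * (m * (CARD('n) + 2) / 3) / (CARD('n) + 2)"
    by (simp add: add_nonneg_eq_0_iff)
  ultimately have "m = 3 * (unit_ball_vol CARD('n) / CARD('n)) / (CARD('n) + 2)"
    by (simp only:)
  then have "m = 3 * unit_ball_vol CARD('n) / (CARD('n) * (CARD('n) + 2))"
    by (simp add: algebra_simps)
  then show ?thesis using eq[of v] by simp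
qed

text \<open>The derivative of the fourth moment at v in direction u, obtained by finite differences.
  With steps 1 and 2 weighted by 8 and -1, the odd differences lose their cubic term and keep 12
  times the linear one; that linear term carries the binomial factor 4, hence 48.\<close>

lemma sphere_moment_31:
  fixes v u :: "real ^ 'n"
  shows "sphere_moment (\<lambda>w. (w \<bullet> v) ^ 3 * (w \<bullet> u)) =
    3 * unit_ball_vol CARD('n) / (CARD('n) * (CARD('n) + 2)) * ((norm v)\<^sup>2 * (v \<bullet> u))"
proof -
  let ?M = "\<lambda>v :: real ^ 'n. sphere_moment (\<lambda>w. (w \<bullet> v) ^ 4)"
  let ?K = "3 * unit_ball_vol CARD('n) / (CARD('n) * (CARD('n) + 2))"
  text \<open>This combination of values of the quartic isolates its part that is linear in \<open>u\<close>.\<close>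
  have "(\<lambda>w. 8 * (w \<bullet> (v + u)) ^ 4 + (w \<bullet> (v - 2 *\<^sub>R u)) ^ 4) =
      (\<lambda>w. 8 * (w \<bullet> (v - u)) ^ 4 + ((w \<bullet> (v + 2 *\<^sub>R u)) ^ 4 + 48 * ((w \<bullet> v) ^ 3 * (w \<bullet> u))))"
    by (rule ext, unfold inner_add_right inner_diff_right inner_scaleR_right, algebra)
  from arg_cong[OF this, of sphere_moment] have "8 * ?M (v + u) + ?M (v - 2 *\<^sub>R u) =
      8 * ?M (v - u) + (?M (v + 2 *\<^sub>R u) + 48 * sphere_moment (\<lambda>w. (w \<bullet> v) ^ 3 * (w \<bullet> u)))"
    by (simp add: sphere_moment_add sphere_moment_cmult continuous_on_add continuous_on_mult
        continuous_on_power continuous_on_inner continuous_on_const)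
  moreover have "norm z ^ 4 = (z \<bullet> z)\<^sup>2" for z :: "real ^ 'n"
    by (simp add: power2_norm_eq_inner[symmetric] power_mult[symmetric])
  ultimately have "48 * sphere_moment (\<lambda>w. (w \<bullet> v) ^ 3 * (w \<bullet> u)) =
      ?K * (8 * ((v + u) \<bullet> (v + u))\<^sup>2 + ((v - 2 *\<^sub>R u) \<bullet> (v - 2 *\<^sub>R u))\<^sup>2
        - 8 * ((v - u) \<bullet> (v - u))\<^sup>2 - ((v + 2 *\<^sub>R u) \<bullet> (v + 2 *\<^sub>R u))\<^sup>2)"
    unfolding sphere_moment_4 by (simp only: algebra_simps)
  also have "\<dots> = ?K * (48 * ((v \<bullet> v) * (v \<bullet> u)))"
    by (rule arg_cong[of _ _ "(*) ?K"])
       (simp add: inner_simps inner_commute[of u v] power2_eq_square algebra_simps)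
  finally show ?thesis by (simp add: power2_norm_eq_inner)
qed

section \<open>Singular integrals\<close>

lemma nn_integral_sphere_moment:
  fixes F :: "real ^ 'n \<Rightarrow> real"
  assumes F: "continuous_on UNIV F" "\<And>h. F (unit_vec h) \<ge> 0"
  shows "(\<integral>\<^sup>+h. ennreal (F (unit_vec h)) * indicator (cball 0 1) h \<partial>lborel) = ennreal (sphere_moment F)"
    and "sphere_moment F \<ge> 0"
proof -
  show "sphere_moment F \<ge> 0"
    unfolding sphere_moment_def set_lebesgue_integral_def
    by (rule Bochner_Integration.integral_nonneg) (simp add: F)
  have "(\<integral>\<^sup>+h. ennreal (indicator (cball 0 1) h *\<^sub>R F (unit_vec h)) \<partial>lborel) = ennreal (sphere_moment F)"
    unfolding sphere_moment_def set_lebesgue_integral_def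
    by (rule nn_integral_eq_integral)
       (use sphere_moment_integrable[OF F(1)] F(2) in \<open>simp_all add: set_integrable_def\<close>)
  then show "(\<integral>\<^sup>+h. ennreal (F (unit_vec h)) * indicator (cball 0 1) h \<partial>lborel) = ennreal (sphere_moment F)"
    by (simp add: mult.commute[of "ennreal _"] ennreal_mult' ennreal_indicator)
qed

text \<open>The exponent is normalised so that the Jacobian \<open>t ^ (CARD('n) - 1)\<close> leaves
  \<open>t powr (p - 1)\<close>, integrable at 0 exactly because p is positive.\<close>

lemma has_bochner_integral_powr_cball_nonneg:
  fixes F :: "real ^ 'n \<Rightarrow> real"
  assumes F: "continuous_on UNIV F" "\<And>h. F (unit_vec h) \<ge> 0" and "p > 0" "r > 0"
  shows "has_bochner_integral lborel
    (\<lambda>h. indicator (cball 0 r) h * (norm h powr (p - real CARD('n)) * F (unit_vec h)))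
    (real CARD('n) * sphere_moment F * (r powr p / p))"
proof (rule has_bochner_integral_nn_integral)
  let ?d = "CARD('n)"
  have [measurable]: "F \<in> borel_measurable borel" "cball 0 r \<in> sets (borel :: (real ^ 'n) measure)"
    using F by (auto intro: borel_measurable_continuous_onI)
  show "(\<lambda>h. indicator (cball 0 r) h * (norm h powr (p - real ?d) * F (unit_vec h))) \<in> borel_measurable lborel"
    by measurable
  have "(\<integral>\<^sup>+h. ennreal (indicator (cball 0 r) h * (norm h powr (p - real ?d) * F (unit_vec h))) \<partial>lborel)
      = (\<integral>\<^sup>+h. ennreal (F (unit_vec h)) * (ennreal (norm h powr (p - real ?d)) * indicator {..r} (norm h)) \<partial>lborel)"
    by (rule nn_integral_cong) (auto simp: indicator_def ennreal_mult' F mult.commute)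
  also have "\<dots> = ennreal (sphere_moment F) * (\<integral>\<^sup>+t. ennreal (t powr (p - real ?d)) * indicator {..r} t *
      (ennreal (real ?d * t ^ (?d - 1)) * indicator {0<..} t) \<partial>lborel)"
    by (rule nn_integral_polar) (use F in \<open>auto intro!: nn_integral_sphere_moment borel_measurable_continuous_onI\<close>)
  also have "(\<integral>\<^sup>+t. ennreal (t powr (p - real ?d)) * indicator {..r} t *
      (ennreal (real ?d * t ^ (?d - 1)) * indicator {0<..} t) \<partial>lborel) =
      (\<integral>\<^sup>+t. ennreal (real ?d) * (ennreal (t powr (p - 1)) * indicator {0..r} t) \<partial>lborel)"
  proof (rule nn_integral_cong_AE, use AE_lborel_neq[of "0::real"] in eventually_elim)
    fix t :: real assume "t \<noteq> 0"
    show "ennreal (t powr (p - real ?d)) * indicator {..r} t * (ennreal (real ?d * t ^ (?d - 1)) * indicator {0<..} t)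
        = ennreal (real ?d) * (ennreal (t powr (p - 1)) * indicator {0..r} t)"
    proof (cases "0 < t \<and> t \<le> r")
      case True
      have "t ^ (?d - 1) = t powr (real ?d - 1)"
        using True by (simp add: powr_realpow[symmetric] of_nat_diff)
      then have "t powr (p - real ?d) * (real ?d * t ^ (?d - 1)) = real ?d * t powr (p - 1)"
        using True by (simp add: powr_add[symmetric])
      with True show ?thesis by (simp add: ennreal_mult'[symmetric] del: of_nat_diff)
    next
      case False
      with \<open>t \<noteq> 0\<close> show ?thesis by (auto simp: indicator_def)
    qed
  qed
  also have "\<dots> = ennreal (real ?d) * ennreal (r powr p / p)"
    using nn_integral_has_integral_lebesgue'[OF _ has_integral_powr_from_0[of "p - 1" r]] assms
    by (simp add: nn_integral_cmult)
  finally show "(\<integral>\<^sup>+h. ennreal (indicator (cball 0 r) h * (norm h powr (p - real ?d) * F (unit_vec h))) \<partial>lborel)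
      = ennreal (real ?d * sphere_moment F * (r powr p / p))"
    using assms nn_integral_sphere_moment(2)[OF F]
    by (simp add: ennreal_mult'[symmetric] mult_ac)
qed (use assms nn_integral_sphere_moment(2)[OF F] in auto)

text \<open>Adding a constant C that bounds F on directions reduces signed F to the nonnegative
  case; the contribution of C is then subtracted.\<close>

lemma has_bochner_integral_powr_cball:
  fixes F :: "real ^ 'n \<Rightarrow> real"
  assumes F: "continuous_on UNIV F" and "p > 0" "r > 0"
  shows "has_bochner_integral lborel
    (\<lambda>h. indicator (cball 0 r) h * (norm h powr (p - real CARD('n)) * F (unit_vec h)))
    (real CARD('n) * sphere_moment F * (r powr p / p))"
proof -
  obtain C where C: "C \<ge> 0" "\<And>h. \<bar>F (unit_vec h)\<bar> \<le> C"
    using continuous_unit_vec_bounded[OF F] by blast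
  have "F (unit_vec h) + C \<ge> 0" for h
    using C(2)[of h] by linarith
  then have 1: "has_bochner_integral lborel
    (\<lambda>h. indicator (cball 0 r) h * (norm h powr (p - real CARD('n)) * (F (unit_vec h) + C)))
    (real CARD('n) * sphere_moment (\<lambda>w. F w + C) * (r powr p / p))"
    using assms by (intro has_bochner_integral_powr_cball_nonneg[of "\<lambda>w. F w + C"] continuous_intros) auto
  have 2: "has_bochner_integral lborel
    (\<lambda>h :: real ^ 'n. indicator (cball 0 r) h * (norm h powr (p - real CARD('n)) * C))
    (real CARD('n) * sphere_moment (\<lambda>w :: real ^ 'n. C) * (r powr p / p))"
    using assms C by (intro has_bochner_integral_powr_cball_nonneg[of "\<lambda>w :: real ^ 'n. C"] continuous_intros) auto
  have 3: "sphere_moment (\<lambda>w. F w + C) = sphere_moment F + sphere_moment (\<lambda>w :: real ^ 'n. C)"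
    using F by (intro sphere_moment_add continuous_intros)
  from has_bochner_integral_diff[OF 1 2] show ?thesis
    unfolding 3 by (simp add: algebra_simps add_divide_distrib)
qed

lemma has_bochner_integral_powr_outside:
  assumes "q > 0" "r > 0"
  shows "has_bochner_integral lborel
    (\<lambda>h :: real ^ 'n. indicator (- cball 0 r) h * norm h powr (- real CARD('n) - q))
    (real CARD('n) * unit_ball_vol CARD('n) * (r powr (- q) / q))"
proof (rule has_bochner_integral_nn_integral)
  let ?d = "CARD('n)"
  have [measurable]: "cball 0 r \<in> sets (borel :: (real ^ 'n) measure)" by simp
  show "(\<lambda>h :: real ^ 'n. indicator (- cball 0 r) h * norm h powr (- real ?d - q)) \<in> borel_measurable lborel"
    by measurable
  have "(\<integral>\<^sup>+(h :: real ^ 'n). ennreal (indicator (- cball 0 r) h * norm h powr (- real ?d - q)) \<partial>lborel)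
      = (\<integral>\<^sup>+(h :: real ^ 'n). ennreal 1 * (ennreal (norm h powr (- real ?d - q)) * indicator {r<..} (norm h)) \<partial>lborel)"
    by (rule nn_integral_cong) (auto simp: indicator_def)
  also have "\<dots> = ennreal (unit_ball_vol ?d) * (\<integral>\<^sup>+t. ennreal (t powr (- real ?d - q)) * indicator {r<..} t *
      (ennreal (real ?d * t ^ (?d - 1)) * indicator {0<..} t) \<partial>lborel)"
    using nn_integral_sphere_moment[of "\<lambda>w :: real ^ 'n. 1"] unfolding sphere_moment_one
    by (intro nn_integral_polar) auto
  also have "(\<integral>\<^sup>+t. ennreal (t powr (- real ?d - q)) * indicator {r<..} t *
      (ennreal (real ?d * t ^ (?d - 1)) * indicator {0<..} t) \<partial>lborel) =
      (\<integral>\<^sup>+t. ennreal (real ?d) * (ennreal (t powr (- q - 1)) * indicator {r..} t) \<partial>lborel)"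
  proof (rule nn_integral_cong_AE, use AE_lborel_neq[of "r::real"] in eventually_elim)
    fix t :: real assume "t \<noteq> r"
    show "ennreal (t powr (- real ?d - q)) * indicator {r<..} t * (ennreal (real ?d * t ^ (?d - 1)) * indicator {0<..} t)
        = ennreal (real ?d) * (ennreal (t powr (- q - 1)) * indicator {r..} t)"
    proof (cases "r < t")
      case True
      then have "t > 0" using assms by simp
      then have "t ^ (?d - 1) = t powr (real ?d - 1)"
        by (simp add: powr_realpow[symmetric] of_nat_diff)
      then have "t powr (- real ?d - q) * (real ?d * t ^ (?d - 1)) = real ?d * t powr (- q - 1)"
        using \<open>t > 0\<close> by (simp add: powr_add[symmetric])
      with True \<open>t > 0\<close> show ?thesis by (simp add: ennreal_mult'[symmetric] del: of_nat_diff)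
    next
      case False
      with \<open>t \<noteq> r\<close> show ?thesis by (auto simp: indicator_def)
    qed
  qed
  also have "\<dots> = ennreal (real ?d) * ennreal (r powr (- q) / q)"
    using nn_integral_has_integral_lebesgue'[OF _ has_integral_powr_to_inf[of "- q - 1" r]] assms
    by (simp add: nn_integral_cmult)
  finally show "(\<integral>\<^sup>+(h :: real ^ 'n). ennreal (indicator (- cball 0 r) h * norm h powr (- real ?d - q)) \<partial>lborel)
      = ennreal (real ?d * unit_ball_vol ?d * (r powr (- q) / q))"
    using assms by (simp add: ennreal_mult'[symmetric] mult_ac)
qed (use assms in auto)

section \<open>Blow-up of the singular integrals as s tends to 1\<close>

context
  fixes N F :: "real ^ 'n \<Rightarrow> real" and C r :: real
  assumes N_measurable [measurable]: "N \<in> borel_measurable borel"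
    and F: "continuous_on UNIV F"
    and r: "r > 0"
    and N_bound: "\<And>h. \<bar>N h\<bar> \<le> C"
    and N_expand: "\<And>h. norm h \<le> r \<Longrightarrow> \<bar>N h - (norm h)\<^sup>2 * F (unit_vec h)\<bar> \<le> C * norm h ^ 3"
begin

text \<open>Inside the ball of radius r the quadratic model is integrated exactly and the cubic
  error raises the exponent by one; outside, only boundedness of N is used. The factor 1 / (2 - 2s)
  occurs in the main term alone, while both errors stay bounded as s tends to 1.\<close>

lemma singular_integral_estimate:
  assumes s: "s \<in> {0<..<1}"
  shows "integrable lborel (\<lambda>h. norm h powr (- real CARD('n) - 2 * s) * N h)"
    and "\<bar>(LINT h|lborel. norm h powr (- real CARD('n) - 2 * s) * N h)
        - real CARD('n) * sphere_moment F * (r powr (2 - 2 * s) / (2 - 2 * s))\<bar>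
      \<le> C * (real CARD('n) * unit_ball_vol CARD('n) * (r powr (3 - 2 * s) / (3 - 2 * s)))
        + C * (real CARD('n) * unit_ball_vol CARD('n) * (r powr (- (2 * s)) / (2 * s)))"
proof -
  let ?d = "real CARD('n)" and ?V = "unit_ball_vol CARD('n)"
  let ?f = "\<lambda>h. norm h powr (- ?d - 2 * s) * N h"
  let ?main = "\<lambda>h. indicator (cball 0 r) h * (norm h powr (2 - 2 * s - ?d) * F (unit_vec h))"
  let ?err = "\<lambda>h :: real ^ 'n. C * (indicator (cball 0 r) h * (norm h powr (3 - 2 * s - ?d) * 1))
      + C * (indicator (- cball 0 r) h * norm h powr (- ?d - 2 * s))"
  have [measurable]: "cball 0 r \<in> sets (borel :: (real ^ 'n) measure)" by simp
  have main: "has_bochner_integral lborel ?main (?d * sphere_moment F * (r powr (2 - 2 * s) / (2 - 2 * s)))"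
    using s r by (intro has_bochner_integral_powr_cball F) auto
  have err1: "has_bochner_integral lborel
      (\<lambda>h :: real ^ 'n. indicator (cball 0 r) h * (norm h powr (3 - 2 * s - ?d) * 1))
      (?d * ?V * (r powr (3 - 2 * s) / (3 - 2 * s)))"
    unfolding sphere_moment_one[symmetric]
    by (rule has_bochner_integral_powr_cball) (use s r in auto)
  have err2: "has_bochner_integral lborel
      (\<lambda>h :: real ^ 'n. indicator (- cball 0 r) h * norm h powr (- ?d - 2 * s))
      (?d * ?V * (r powr (- (2 * s)) / (2 * s)))"
    by (rule has_bochner_integral_powr_outside) (use s r in auto)
  have err: "has_bochner_integral lborel ?err
      (C * (?d * ?V * (r powr (3 - 2 * s) / (3 - 2 * s))) + C * (?d * ?V * (r powr (- (2 * s)) / (2 * s))))"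
    by (rule has_bochner_integral_add; rule has_bochner_integral_mult_right; rule err1 err2)
  have le: "norm (?f h - ?main h) \<le> ?err h" if "h \<noteq> 0" for h
  proof (cases "norm h \<le> r")
    case True
    have p: "norm h powr (2 - 2 * s - ?d) = norm h powr (- ?d - 2 * s) * (norm h)\<^sup>2"
      "norm h powr (3 - 2 * s - ?d) = norm h powr (- ?d - 2 * s) * norm h ^ 3"
      using powr_add[of "norm h" "- ?d - 2 * s" "real 2"] powr_add[of "norm h" "- ?d - 2 * s" "real 3"]
        powr_realpow[of "norm h" 2] powr_realpow[of "norm h" 3] that
      by (simp_all only: norm_eq_zero zero_less_norm_iff not_False_eq_True simp_thms) (simp_all add: algebra_simps)
    have "?f h - ?main h = norm h powr (- ?d - 2 * s) * (N h - (norm h)\<^sup>2 * F (unit_vec h))"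
      unfolding p(1) using True by (simp add: right_diff_distrib)
    then have "norm (?f h - ?main h) = norm h powr (- ?d - 2 * s) * \<bar>N h - (norm h)\<^sup>2 * F (unit_vec h)\<bar>"
      by (simp add: abs_mult)
    also have "\<dots> \<le> norm h powr (- ?d - 2 * s) * (C * norm h ^ 3)"
      by (intro mult_left_mono N_expand True) simp
    also have "\<dots> = ?err h" unfolding p(2) using True by simp
    finally show ?thesis .
  next
    case False
    then show ?thesis using mult_left_mono[OF N_bound[of h], of "norm h powr (- ?d - 2 * s)"]
      by (simp add: abs_mult mult.commute)
  qed
  have AE: "AE h in lborel. norm (?f h - ?main h) \<le> ?err h"
    using AE_lborel_neq[of "0 :: real ^ 'n"] by eventually_elim (rule le)
  have [measurable]: "F \<in> borel_measurable borel" using F by (rule borel_measurable_continuous_onI)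
  have int_err: "integrable lborel ?err" and int_main: "integrable lborel ?main"
    using err main by (auto simp: has_bochner_integral_iff)
  have diff: "integrable lborel (\<lambda>h. ?f h - ?main h)"
  proof (rule Bochner_Integration.integrable_bound[OF int_err])
    show "AE h in lborel. norm (?f h - ?main h) \<le> norm (?err h)"
      using AE by eventually_elim (rule order_trans, assumption, simp)
  qed measurable
  from Bochner_Integration.integrable_add[OF diff int_main]
  show int: "integrable lborel ?f" by simp
  have "\<bar>(LINT h|lborel. ?f h) - integral\<^sup>L lborel ?main\<bar> = norm (LINT h|lborel. ?f h - ?main h)"
    using int int_main by (subst Bochner_Integration.integral_diff) simp_all
  also have "\<dots> \<le> integral\<^sup>L lborel ?err"
    by (rule order_trans[OF integral_norm_bound], rule integral_mono_AE[OF integrable_norm[OF diff] int_err AE])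
  finally show "\<bar>(LINT h|lborel. ?f h) - ?d * sphere_moment F * (r powr (2 - 2 * s) / (2 - 2 * s))\<bar>
      \<le> C * (?d * ?V * (r powr (3 - 2 * s) / (3 - 2 * s))) + C * (?d * ?V * (r powr (- (2 * s)) / (2 * s)))"
    using main err by (simp only: has_bochner_integral_integral_eq)
qed

text \<open>Multiplication by 1 - s turns 1 / (2 - 2s) into 1/2 and sends the errors to 0. As
  \<open>r powr (2 - 2 * s)\<close> tends to 1, the limit does not depend on r.\<close>

lemma singular_integral_tendsto:
  "((\<lambda>s. (1 - s) * (LINT h|lborel. norm h powr (- real CARD('n) - 2 * s) * N h)) \<longlongrightarrow>
    real CARD('n) / 2 * sphere_moment F) (at_left 1)"
proof -
  let ?d = "real CARD('n)" and ?V = "unit_ball_vol CARD('n)"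
  let ?I = "\<lambda>s. LINT h|lborel. norm h powr (- ?d - 2 * s) * N h"
  let ?m = "\<lambda>s. ?d * sphere_moment F * (r powr (2 - 2 * s) / 2)"
  let ?e = "\<lambda>s. C * (?d * ?V * (r powr (3 - 2 * s) / (3 - 2 * s))) + C * (?d * ?V * (r powr (- (2 * s)) / (2 * s)))"
  have ev: "\<forall>\<^sub>F s in at_left (1::real). s \<in> {0<..<1}"
    using eventually_at_left_real[of 0 1] by simp
  have "((\<lambda>s. (1 - s) * ?I s - ?m s) \<longlongrightarrow> 0) (at_left 1)"
  proof (rule Lim_null_comparison)
    show "\<forall>\<^sub>F s in at_left 1. norm ((1 - s) * ?I s - ?m s) \<le> (1 - s) * ?e s"
      using ev
    proof eventually_elim
      case (elim s)
      then have "(1 - s) * ?I s - ?m s =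
          (1 - s) * (?I s - ?d * sphere_moment F * (r powr (2 - 2 * s) / (2 - 2 * s)))"
        by (simp add: field_simps)
      then show ?case
        using elim mult_left_mono[OF singular_integral_estimate(2)[OF elim], of "1 - s"]
        by (simp add: abs_mult)
    qed
    show "((\<lambda>s. (1 - s) * ?e s) \<longlongrightarrow> 0) (at_left 1)"
      using r by (auto intro!: tendsto_eq_intros)
  qed
  moreover have "(?m \<longlongrightarrow> ?d * sphere_moment F * (r powr (2 - 2 * 1) / 2)) (at_left 1)"
    using r by (intro tendsto_intros) auto
  ultimately have "((\<lambda>s. ((1 - s) * ?I s - ?m s) + ?m s) \<longlongrightarrow> 0 + ?d * sphere_moment F * (r powr (2 - 2 * 1) / 2)) (at_left 1)"
    by (rule tendsto_add)
  then show ?thesis using r by (simp add: mult.commute mult.left_commute)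
qed

end

text \<open>Two applications of the functional equation give Gamma(2 - s) = (1 - s)(-s) Gamma(-s):
  the pole of Gamma at -1 is the simple zero of \<open>kappa\<close>. What remains is continuous at
  s = 1, with value 2 Gamma(d/2 + 1) / pi^(d/2).\<close>

lemma kappa_tendsto:
  "((\<lambda>s. kappa d s / (1 - s)) \<longlongrightarrow> 2 / unit_ball_vol d) (at_left 1)"
proof -
  have ev: "\<forall>\<^sub>F s in at_left (1::real). s \<in> {0<..<1}"
    using eventually_at_left_real[of 0 1] by simp
  have *: "kappa d s / (1 - s) =
      2 powr (2 * s - 1) * Gamma (real d / 2 + s) * s / (pi powr (real d / 2) * Gamma (2 - s))"
    if "s \<in> {0<..<1}" for s
  proof -
    have "- s \<notin> \<int>"
    proof
      assume "- s \<in> \<int>"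
      then obtain n where "- s = of_int n" by (elim Ints_cases)
      with that have "of_int (- 1) < (of_int n :: real)" "of_int n < (of_int 0 :: real)" by auto
      then show False unfolding of_int_less_iff by linarith
    qed
    then have n: "- s \<notin> \<int>\<^sub>\<le>\<^sub>0" "1 - s \<notin> \<int>\<^sub>\<le>\<^sub>0"
      using that nonpos_Ints_nonpos[of "1 - s"] by (auto dest: nonpos_Ints_Int)
    have "Gamma (2 - s) = (1 - s) * ((- s) * Gamma (- s))"
      using Gamma_plus1[OF n(1)] Gamma_plus1[OF n(2)] by (simp add: algebra_simps)
    moreover have pos: "Gamma (2 - s) > 0" using that by (intro Gamma_real_pos) auto
    ultimately have "Gamma (2 - s) = \<bar>(1 - s) * ((- s) * Gamma (- s))\<bar>"
      by linarith
    then have "Gamma (2 - s) = (1 - s) * s * \<bar>Gamma (- s)\<bar>"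
      using that by (simp add: abs_mult)
    with that pos have "\<bar>Gamma (- s)\<bar> > 0" and G: "\<bar>Gamma (- s)\<bar> = Gamma (2 - s) / ((1 - s) * s)"
      by (auto simp: zero_less_mult_iff)
    show ?thesis using that pos unfolding kappa_def G by (simp add: divide_simps)
  qed
  have "((\<lambda>s. 2 powr (2 * s - 1) * Gamma (real d / 2 + s) * s / (pi powr (real d / 2) * Gamma (2 - s))) \<longlongrightarrow>
      2 powr (2 * 1 - 1) * Gamma (real d / 2 + 1) * 1 / (pi powr (real d / 2) * Gamma (2 - 1))) (at_left 1)"
    by (intro tendsto_intros tendsto_Gamma) (auto elim!: nonpos_Ints_cases)
  then have "((\<lambda>s. 2 powr (2 * s - 1) * Gamma (real d / 2 + s) * s / (pi powr (real d / 2) * Gamma (2 - s))) \<longlongrightarrow>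
      2 / unit_ball_vol d) (at_left 1)"
    by (simp add: unit_ball_vol_def)
  then show ?thesis
    by (rule Lim_transform_eventually) (use ev in \<open>eventually_elim, simp only: *\<close>)
qed

section \<open>The local operator\<close>

lemma u_fun_eq: "u_fun e \<delta> x = norm x powr (- \<delta>) * x $ e"
proof (cases "x = 0")
  case False
  then have "norm x powr (1 - \<delta>) = norm x powr (- \<delta>) * norm x"
    using powr_add[of "norm x" "- \<delta>" 1] by simp
  with False show ?thesis by (simp add: u_fun_def)
qed (simp add: u_fun_def)

lemma partial_eqI:
  assumes "((\<lambda>t. f (x + t *\<^sub>R axis i 1)) has_real_derivative D) (at 0)"
  shows "partial i f x = D"
  unfolding partial_def using assms by (rule DERIV_imp_deriv)

lemma norm_powr_deriv:
  fixes x :: "real ^ 'n"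
  assumes "x \<noteq> 0"
  shows "((\<lambda>t. norm (x + t *\<^sub>R axis i 1) powr a) has_real_derivative
    a * norm x powr (a - 2) * x $ i) (at 0)"
proof -
  have *: "norm y powr b = (y \<bullet> y) powr (b / 2)" for y :: "real ^ 'n" and b
    by (simp add: norm_eq_sqrt_inner powr_half_sqrt[symmetric] powr_powr)
  \<comment> \<open>Along the line the squared norm is a quadratic polynomial in t, so the norm
    itself need not be differentiated.\<close>
  have "(\<lambda>t. norm (x + t *\<^sub>R axis i 1) powr a) = (\<lambda>t. (x \<bullet> x + 2 * t * x $ i + t * t) powr (a / 2))"
    unfolding * by (simp add: inner_simps inner_axis inner_axis' fun_eq_iff algebra_simps)
  moreover have "((\<lambda>t. (x \<bullet> x + 2 * t * x $ i + t * t) powr (a / 2)) has_real_derivative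
      a * norm x powr (a - 2) * x $ i) (at 0)"
    unfolding * using assms by (auto intro!: derivative_eq_intros simp: diff_divide_distrib)
  ultimately show ?thesis by simp
qed

text \<open>The closed form of the flux is available off the origin; to differentiate it at x it
  must hold along a whole piece of the line through x.\<close>

lemma eventually_line_neq_0:
  fixes x :: "real ^ 'n"
  assumes "x \<noteq> 0"
  shows "\<forall>\<^sub>F t in nhds (0::real). x + t *\<^sub>R axis i 1 \<noteq> 0"
proof -
  have "((\<lambda>t::real. x + t *\<^sub>R axis i 1) \<longlongrightarrow> x + 0 *\<^sub>R axis i 1) (nhds 0)"
    by (intro tendsto_intros filterlim_ident)
  then show ?thesis using assms tendsto_imp_eventually_ne by fastforce
qed

lemma grad_u_fun:
  fixes x :: "real ^ 'n"
  assumes "x \<noteq> 0"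
  shows "grad (u_fun e \<delta>) x =
    norm x powr (- \<delta>) *\<^sub>R axis e 1 - (\<delta> * norm x powr (- \<delta> - 2) * x $ e) *\<^sub>R x"
proof -
  have "partial i (u_fun e \<delta>) x =
      norm x powr (- \<delta>) * axis e 1 $ i - \<delta> * norm x powr (- \<delta> - 2) * x $ e * x $ i" for i
  proof (rule partial_eqI)
    have "((\<lambda>t. (x + t *\<^sub>R axis i 1) $ e) has_real_derivative axis e 1 $ i) (at 0)"
      by (auto intro!: derivative_eq_intros simp: axis_def)
    from DERIV_mult[OF norm_powr_deriv[OF assms, where a = "- \<delta>" and i = i] this]
    show "((\<lambda>t. u_fun e \<delta> (x + t *\<^sub>R axis i 1)) has_real_derivative
        norm x powr (- \<delta>) * axis e 1 $ i - \<delta> * norm x powr (- \<delta> - 2) * x $ e * x $ i) (at 0)"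
      unfolding u_fun_eq by (simp add: mult_ac)
  qed
  then show ?thesis by (simp add: grad_def vec_eq_iff)
qed

lemma outer_mult_vec: "outer v w *v g = (w \<bullet> g) *\<^sub>R v"
  by (simp add: matrix_vector_mult_def outer_def vec_eq_iff inner_vec_def sum_distrib_left mult_ac)

lemma A_local_mult: "A_local \<epsilon> y *v g = (1 - \<epsilon>) *\<^sub>R g + (\<epsilon> * (unit_vec y \<bullet> g)) *\<^sub>R unit_vec y"
  by (simp add: A_local_def matrix_vector_mult_add_rdistrib outer_mult_vec scaleR_matrix_vector_assoc[symmetric])

text \<open>The gradient has radial coefficient -delta, and its radial derivative carries the factor
  1 - delta; the matrix combines them to -(1 - eps) delta + eps (1 - delta) = eps - delta.\<close>

lemma flux_u_fun:
  fixes y :: "real ^ 'n"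
  assumes "y \<noteq> 0"
  shows "A_local \<epsilon> y *v grad (u_fun e \<delta>) y =
    ((1 - \<epsilon>) * norm y powr (- \<delta>)) *\<^sub>R axis e 1 + ((\<epsilon> - \<delta>) * norm y powr (- \<delta> - 2) * y $ e) *\<^sub>R y"
proof -
  have p: "norm y powr (- \<delta>) = norm y powr (- \<delta> - 2) * (norm y)\<^sup>2"
    using powr_add[of "norm y" "- \<delta> - 2" 2] assms by (simp add: powr_numeral)
  have n: "y \<bullet> y = (norm y)\<^sup>2" by (simp add: power2_norm_eq_inner)
  let ?P = "norm y powr (- \<delta> - 2)"
  have ax: "y \<bullet> axis e 1 = y $ e" by (simp add: inner_axis)
  have uv: "unit_vec y \<bullet> grad (u_fun e \<delta>) y = (1 - \<delta>) * ?P * norm y * y $ e"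
    unfolding grad_u_fun[OF assms] p unit_vec_def
    using assms by (simp add: inner_diff_right ax n power2_eq_square field_simps)
  have "norm y * inverse (norm y) = 1" using assms by simp
  then have c: "norm y * (inverse (norm y) * r) = r" for r
    by (simp only: mult.assoc[symmetric] mult_1)
  show ?thesis
    unfolding A_local_mult uv
    using assms by (simp add: c grad_u_fun unit_vec_def vec_eq_iff algebra_simps)
qed

text \<open>The radial part of the flux is f(y) y with f homogeneous of degree -delta - 1, so by
  Euler's identity its divergence is (n - 1 - delta) f. The part along the fixed axis contributes
  -delta (1 - eps).\<close>

lemma local_op_u_fun:
  fixes x :: "real ^ 'n"
  assumes x: "x \<noteq> 0"
  shows "local_op \<epsilon> (u_fun e \<delta>) x =
    norm x powr (- \<delta> - 2) * x $ e * (\<delta> * (real CARD('n) - \<delta>) - \<epsilon> * (real CARD('n) - 1))"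
proof -
  let ?P = "norm x powr (- \<delta> - 2)" and ?Q = "norm x powr (- \<delta> - 4)"
  have Q: "?P = ?Q * (x \<bullet> x)"
  proof -
    have "?P = norm x powr ((- \<delta> - 4) + 2)" by (simp add: algebra_simps)
    also have "\<dots> = ?Q * (x \<bullet> x)"
      unfolding powr_add using x by (simp add: power2_norm_eq_inner)
    finally show ?thesis .
  qed
  have "partial i (\<lambda>y. (A_local \<epsilon> y *v grad (u_fun e \<delta>) y) $ i) x =
      (1 - \<epsilon>) * (- \<delta> * ?P * x $ i) * axis e 1 $ i
      + (\<epsilon> - \<delta>) * ((- \<delta> - 2) * ?Q * x $ i * x $ e * x $ i + ?P * (axis e 1 $ i * x $ i + x $ e))" for i
  proof (rule partial_eqI)
    have c: "((\<lambda>t. (x + t *\<^sub>R axis i 1) $ k) has_real_derivative axis k 1 $ i) (at 0)" for k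
      by (auto intro!: derivative_eq_intros simp: axis_def)
    have "((\<lambda>t. (1 - \<epsilon>) * norm (x + t *\<^sub>R axis i 1) powr (- \<delta>) * axis e 1 $ i
        + (\<epsilon> - \<delta>) * norm (x + t *\<^sub>R axis i 1) powr (- \<delta> - 2) * (x + t *\<^sub>R axis i 1) $ e * (x + t *\<^sub>R axis i 1) $ i)
      has_real_derivative
      (1 - \<epsilon>) * (- \<delta> * ?P * x $ i) * axis e 1 $ i
      + (\<epsilon> - \<delta>) * ((- \<delta> - 2) * ?Q * x $ i * x $ e * x $ i + ?P * (axis e 1 $ i * x $ i + x $ e))) (at 0)"
      by (rule derivative_eq_intros norm_powr_deriv[OF x] c refl)+ (simp add: algebra_simps)
    moreover have "\<forall>\<^sub>F t in nhds 0. (1 - \<epsilon>) * norm (x + t *\<^sub>R axis i 1) powr (- \<delta>) * axis e 1 $ i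
        + (\<epsilon> - \<delta>) * norm (x + t *\<^sub>R axis i 1) powr (- \<delta> - 2) * (x + t *\<^sub>R axis i 1) $ e * (x + t *\<^sub>R axis i 1) $ i
        = (A_local \<epsilon> (x + t *\<^sub>R axis i 1) *v grad (u_fun e \<delta>) (x + t *\<^sub>R axis i 1)) $ i"
      using eventually_line_neq_0[OF x, of i] by eventually_elim (simp add: flux_u_fun)
    ultimately show "((\<lambda>t. (A_local \<epsilon> (x + t *\<^sub>R axis i 1) *v grad (u_fun e \<delta>) (x + t *\<^sub>R axis i 1)) $ i)
      has_real_derivative
      (1 - \<epsilon>) * (- \<delta> * ?P * x $ i) * axis e 1 $ i
      + (\<epsilon> - \<delta>) * ((- \<delta> - 2) * ?Q * x $ i * x $ e * x $ i + ?P * (axis e 1 $ i * x $ i + x $ e))) (at 0)"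
      by (subst (asm) DERIV_cong_ev[OF refl _ refl])
  qed
  then have "local_op \<epsilon> (u_fun e \<delta>) x = - (\<Sum>i\<in>UNIV. (1 - \<epsilon>) * (- \<delta> * ?P * x $ i) * axis e 1 $ i
      + (\<epsilon> - \<delta>) * ((- \<delta> - 2) * ?Q * x $ i * x $ e * x $ i + ?P * (axis e 1 $ i * x $ i + x $ e)))"
    by (simp add: local_op_def divergence_def)
  also have "\<dots> = - ((1 - \<epsilon>) * (- \<delta> * ?P) * (\<Sum>i\<in>UNIV. x $ i * axis e 1 $ i)
      + (\<epsilon> - \<delta>) * ((- \<delta> - 2) * (?Q * (\<Sum>i\<in>UNIV. x $ i * x $ i)) * x $ e
        + ?P * ((\<Sum>i\<in>UNIV. x $ i * axis e 1 $ i) + real CARD('n) * x $ e)))"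
    by (simp add: sum.distrib sum_distrib_left sum_distrib_right distrib_left distrib_right mult_ac sum_negf sum_subtractf)
  also have "(\<Sum>i\<in>UNIV. x $ i * axis e 1 $ i) = x $ e"
    using inner_axis[of x e 1] by (simp add: inner_vec_def)
  also have "?Q * (\<Sum>i\<in>UNIV. x $ i * x $ i) = ?P"
    unfolding Q by (simp add: inner_vec_def)
  finally show ?thesis by (simp add: algebra_simps)
qed

section \<open>Bounds for u\<close>

lemma u_fun_minus: "u_fun e \<delta> (- x) = - u_fun e \<delta> x"
  by (simp add: u_fun_eq)

lemma u_fun_minus_diff: "u_fun e \<delta> (x - h) = - u_fun e \<delta> (h - x)"
  using u_fun_minus[of e \<delta> "h - x"] by simp

lemma u_fun_measurable [measurable]: "u_fun e \<delta> \<in> borel_measurable borel"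
  unfolding u_fun_eq[abs_def] by measurable

lemma abs_u_fun_le: "\<bar>u_fun e \<delta> x\<bar> \<le> norm x powr (1 - \<delta>)"
proof (cases "x = 0")
  case False
  have "\<bar>u_fun e \<delta> x\<bar> \<le> norm x powr (- \<delta>) * norm x"
    by (simp add: u_fun_eq abs_mult mult_left_mono component_le_norm_cart)
  also have "\<dots> = norm x powr (1 - \<delta>)"
    using False powr_add[of "norm x" "- \<delta>" 1] by simp
  finally show ?thesis .
qed (simp add: u_fun_eq)

text \<open>The weight is frozen at the point of larger norm, through the intermediate value
  \<open>norm a powr (- \<delta>) * b $ e\<close>. Replacing the weight at b costs little because
  t^(-delta) decreases while t^(1-delta) increases, so the estimate never sees the singular weight
  near 0.\<close>

lemma u_fun_diff_le:
  fixes a b :: "real ^ 'n"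
  assumes \<delta>: "0 \<le> \<delta>" "\<delta> \<le> 1" and ab: "norm b \<le> norm a" "a \<noteq> 0"
  shows "\<bar>u_fun e \<delta> a - u_fun e \<delta> b\<bar> \<le> 2 * norm (a - b) * norm a powr (- \<delta>)"
proof -
  have p: "norm x powr (1 - \<delta>) = norm x powr (- \<delta>) * norm x" if "x \<noteq> 0" for x :: "real ^ 'n"
    using that powr_add[of "norm x" "- \<delta>" 1] by simp
  have "\<bar>norm a powr (- \<delta>) * b $ e - u_fun e \<delta> b\<bar> \<le> norm a powr (- \<delta>) * (norm a - norm b)"
  proof (cases "b = 0")
    case False
    have mono: "norm a powr (- \<delta>) \<le> norm b powr (- \<delta>)"
      using \<delta> ab False by (intro powr_mono2') auto
    have "\<bar>norm a powr (- \<delta>) * b $ e - u_fun e \<delta> b\<bar> = (norm b powr (- \<delta>) - norm a powr (- \<delta>)) * \<bar>b $ e\<bar>"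
      unfolding u_fun_eq left_diff_distrib[symmetric] abs_mult using mono by simp
    also have "\<dots> \<le> (norm b powr (- \<delta>) - norm a powr (- \<delta>)) * norm b"
      using mono by (intro mult_left_mono component_le_norm_cart) simp
    also have "\<dots> = norm b powr (1 - \<delta>) - norm a powr (- \<delta>) * norm b"
      unfolding p[OF False] by (simp add: left_diff_distrib)
    also have "norm b powr (1 - \<delta>) \<le> norm a powr (1 - \<delta>)"
      using \<delta> ab by (intro powr_mono2) auto
    finally show ?thesis unfolding p[OF ab(2)] by (simp add: right_diff_distrib)
  qed (simp add: u_fun_eq)
  also have "\<dots> \<le> norm a powr (- \<delta>) * norm (a - b)"
    by (intro mult_left_mono norm_triangle_ineq2) simp
  finally have 1: "\<bar>norm a powr (- \<delta>) * b $ e - u_fun e \<delta> b\<bar> \<le> norm a powr (- \<delta>) * norm (a - b)" .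
  have "\<bar>u_fun e \<delta> a - norm a powr (- \<delta>) * b $ e\<bar> = norm a powr (- \<delta>) * \<bar>(a - b) $ e\<bar>"
  proof -
    have "u_fun e \<delta> a - norm a powr (- \<delta>) * b $ e = norm a powr (- \<delta>) * (a - b) $ e"
      by (simp add: u_fun_eq right_diff_distrib)
    then show ?thesis by (simp add: abs_mult)
  qed
  also have "\<dots> \<le> norm a powr (- \<delta>) * norm (a - b)"
    by (intro mult_left_mono component_le_norm_cart) simp
  finally have 2: "\<bar>u_fun e \<delta> a - norm a powr (- \<delta>) * b $ e\<bar> \<le> norm a powr (- \<delta>) * norm (a - b)" .
  have "2 * norm (a - b) * norm a powr (- \<delta>) = 2 * (norm a powr (- \<delta>) * norm (a - b))" by simp
  with 1 2 show ?thesis by linarith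
qed

text \<open>By oddness the sum is a difference of values at two points at distance \<open>2 * norm x\<close>.\<close>

lemma u_fun_symmetric_sum_le:
  fixes x :: "real ^ 'n"
  assumes \<delta>: "0 \<le> \<delta>" "\<delta> \<le> 1" and x: "x \<noteq> 0"
  shows "\<bar>u_fun e \<delta> (x + h) + u_fun e \<delta> (x - h)\<bar> \<le> 4 * norm x powr (1 - \<delta>)"
proof -
  have *: "\<bar>u_fun e \<delta> a - u_fun e \<delta> b\<bar> \<le> 4 * norm x powr (1 - \<delta>)"
    if "norm b \<le> norm a" "norm (a - b) = 2 * norm x" for a b :: "real ^ 'n"
  proof -
    \<comment> \<open>Two points at distance 2|x| cannot both have norm below |x|.\<close>
    have na: "norm x \<le> norm a" using that norm_triangle_ineq4[of a b] by linarith
    then have "a \<noteq> 0" using x by auto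
    then have "\<bar>u_fun e \<delta> a - u_fun e \<delta> b\<bar> \<le> 2 * (2 * norm x) * norm a powr (- \<delta>)"
      using u_fun_diff_le[OF \<delta> that(1)] that(2) by simp
    also have "\<dots> \<le> 2 * (2 * norm x) * norm x powr (- \<delta>)"
      using na x \<delta> by (intro mult_left_mono powr_mono2') auto
    also have "\<dots> = 4 * norm x powr (1 - \<delta>)"
      using x powr_add[of "norm x" "- \<delta>" 1] by simp
    finally show ?thesis .
  qed
  have e: "x + h - (h - x) = 2 *\<^sub>R x" "h - x - (x + h) = - (2 *\<^sub>R x)"
    by (simp_all add: vec_eq_iff)
  have "norm (x + h - (h - x)) = 2 * norm x" "norm (h - x - (x + h)) = 2 * norm x"
    unfolding e by simp_all
  then have "\<bar>u_fun e \<delta> (x + h) - u_fun e \<delta> (h - x)\<bar> \<le> 4 * norm x powr (1 - \<delta>)"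
    using *[of "h - x" "x + h"] *[of "x + h" "h - x"] by linarith
  then show ?thesis unfolding u_fun_minus_diff[of e \<delta> x h] by simp
qed

text \<open>The quadratic form of the rank one part of \<open>A_nonlocal\<close> at y in the
  direction of h. For fixed y it is even in h, which is what symmetrization relies on.\<close>

definition cos_sq :: "real ^ 'n \<Rightarrow> real ^ 'n \<Rightarrow> real"
  where "cos_sq y h = (unit_vec y \<bullet> unit_vec h)\<^sup>2"

lemma cos_sq_minus [simp]: "cos_sq y (- h) = cos_sq y h"
  by (simp add: cos_sq_def unit_vec_def)

lemma cos_sq_measurable [measurable]:
  "f \<in> borel_measurable borel \<Longrightarrow> (\<lambda>h. cos_sq (f h) h) \<in> borel_measurable borel"
  unfolding cos_sq_def
  by (rule borel_measurable_power, rule borel_measurable_inner,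
      erule measurable_compose[OF _ unit_vec_measurable], rule unit_vec_measurable)

lemma cos_sq_bounds: "0 \<le> cos_sq y h" "cos_sq y h \<le> 1"
proof -
  have "\<bar>unit_vec y \<bullet> unit_vec h\<bar> \<le> 1 * 1"
    by (rule order_trans[OF Cauchy_Schwarz_ineq2 mult_mono]) (simp_all add: norm_unit_vec_le)
  then show "cos_sq y h \<le> 1" by (simp add: cos_sq_def abs_square_le_1)
qed (simp add: cos_sq_def)

text \<open>The sine of the angle between \<open>x + h\<close> and \<open>h\<close> is \<open>O(1 / norm h)\<close>, which compensates
  the growth of \<open>u\<close>.\<close>

lemma sin_sq_le: "(1 - cos_sq (x + h) h) * (norm (x + h))\<^sup>2 \<le> (norm x)\<^sup>2" if "h \<noteq> 0" for x :: "real ^ 'n"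
proof -
  define w where "w = unit_vec h"
  define y where "y = x + h"
  have yh: "y \<bullet> h = norm h * (y \<bullet> w)"
    using that by (simp add: w_def unit_vec_def)
  have "(1 - cos_sq y h) * (norm y)\<^sup>2 = y \<bullet> y - (y \<bullet> w)\<^sup>2"
  proof (cases "y = 0")
    case False
    then have "cos_sq y h * (norm y)\<^sup>2 = (y \<bullet> w)\<^sup>2"
      unfolding cos_sq_def w_def[symmetric] unfolding unit_vec_def
      by (simp add: power_mult_distrib power_inverse)
    then show ?thesis by (simp add: left_diff_distrib power2_norm_eq_inner)
  qed simp
  \<comment> \<open>Pythagoras: the distance of y from the line through h is at most its distance
    from the point h itself, which is |x|.\<close>
  also have "\<dots> \<le> y \<bullet> y - (y \<bullet> w)\<^sup>2 + (norm h - y \<bullet> w)\<^sup>2" by simp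
  also have "\<dots> = y \<bullet> y - 2 * (y \<bullet> h) + h \<bullet> h"
    unfolding yh power2_norm_eq_inner[of h, symmetric] by (simp add: power2_eq_square algebra_simps)
  also have "\<dots> = x \<bullet> x"
    by (simp add: y_def inner_add_left inner_add_right inner_commute[of h x])
  finally show ?thesis by (simp add: y_def power2_norm_eq_inner)
qed

text \<open>If |x + h| <= |x| the bound on u suffices. Otherwise two powers of |x + h| are absorbed
  by the squared sine, and the remaining exponent -1 - delta is negative, so |x + h| may be replaced
  by |x|.\<close>

lemma sin_sq_u_fun_le:
  fixes x :: "real ^ 'n"
  assumes \<delta>: "0 \<le> \<delta>" "\<delta> \<le> 1" and x: "x \<noteq> 0" and h: "h \<noteq> 0"
  shows "\<bar>(1 - cos_sq (x + h) h) * u_fun e \<delta> (x + h)\<bar> \<le> norm x powr (1 - \<delta>)"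
proof (cases "norm (x + h) \<le> norm x")
  case True
  have "\<bar>(1 - cos_sq (x + h) h) * u_fun e \<delta> (x + h)\<bar> \<le> 1 * norm (x + h) powr (1 - \<delta>)"
    unfolding abs_mult by (intro mult_mono abs_u_fun_le) (use cos_sq_bounds[of "x + h" h] in auto)
  also have "\<dots> \<le> norm x powr (1 - \<delta>)"
    using True \<delta> by (simp add: powr_mono2)
  finally show ?thesis .
next
  case False
  then have y: "norm (x + h) > 0" by (meson norm_ge_zero not_le order_le_less_trans)
  have p: "norm z powr (1 - \<delta>) = (norm z)\<^sup>2 * norm z powr (- 1 - \<delta>)" if "norm z > 0" for z :: "real ^ 'n"
    using that powr_add[of "norm z" 2 "- 1 - \<delta>"] by simp
  have "\<bar>(1 - cos_sq (x + h) h) * u_fun e \<delta> (x + h)\<bar> \<le>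
      (1 - cos_sq (x + h) h) * norm (x + h) powr (1 - \<delta>)"
    unfolding abs_mult by (intro mult_mono abs_u_fun_le) (use cos_sq_bounds[of "x + h" h] in auto)
  also have "\<dots> = ((1 - cos_sq (x + h) h) * (norm (x + h))\<^sup>2) * norm (x + h) powr (- 1 - \<delta>)"
    by (simp add: p[OF y])
  also have "\<dots> \<le> (norm x)\<^sup>2 * norm x powr (- 1 - \<delta>)"
    using False \<delta> x h by (intro mult_mono sin_sq_le powr_mono2') auto
  also have "\<dots> = norm x powr (1 - \<delta>)" using p[of x] x by simp
  finally show ?thesis .
qed

section \<open>Expansions at the origin\<close>

text \<open>The filter contains the origin itself, so an estimate extracted from it holds at every h
  of a ball, the form that the singular integral estimates require.\<close>

abbreviation order_of_vanishing :: "nat \<Rightarrow> (real ^ 'n \<Rightarrow> real) set" ("\<O>")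
  where "\<O> k \<equiv> O[nhds 0](\<lambda>h. norm h ^ k)"

lemma vanishing_leI: "(\<And>h. \<bar>f h\<bar> \<le> C * norm h ^ k) \<Longrightarrow> f \<in> \<O> k"
  by (rule bigoI[of _ C]) simp

lemma vanishing_weaken:
  assumes f: "f \<in> \<O> k" and "j \<le> k"
  shows "f \<in> \<O> j"
proof (rule landau_o.big.trans[OF f])
  have "\<forall>\<^sub>F h in nhds (0 :: real ^ 'n). norm h < 1"
    using eventually_nhds_ball[of 1 "0 :: real ^ 'n"] by simp
  then have "\<forall>\<^sub>F h in nhds (0 :: real ^ 'n). norm (norm h ^ k) \<le> 1 * norm (norm h ^ j)"
    by eventually_elim (use assms(2) in \<open>simp add: power_decreasing\<close>)
  then show "(\<lambda>h :: real ^ 'n. norm h ^ k) \<in> \<O> j" by (rule bigoI)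
qed

text \<open>The slack in \<open>m \<le> j + k\<close> combines multiplication with weakening, so
  sums of terms of different orders can be treated uniformly.\<close>

lemma vanishing_mult:
  assumes "f \<in> \<O> j" "g \<in> \<O> k" "m \<le> j + k"
  shows "(\<lambda>h. f h * g h) \<in> \<O> m"
  using landau_o.big.mult[OF assms(1,2)] vanishing_weaken[OF _ assms(3)] by (simp add: power_add)

lemma vanishing_const: "(\<lambda>_. c) \<in> \<O> 0"
  by (rule vanishing_leI[of _ "\<bar>c\<bar>"]) simp

lemma vanishing_cmult: "f \<in> \<O> k \<Longrightarrow> (\<lambda>h. c * f h) \<in> \<O> k"
  by (erule vanishing_mult[OF vanishing_const]) simp

lemma vanishing_add: "f \<in> \<O> k \<Longrightarrow> g \<in> \<O> k \<Longrightarrow> (\<lambda>h. f h + g h) \<in> \<O> k"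
  by (rule sum_in_bigo)

lemma vanishing_diff: "f \<in> \<O> k \<Longrightarrow> g \<in> \<O> k \<Longrightarrow> (\<lambda>h. f h - g h) \<in> \<O> k"
  by (rule sum_in_bigo)

lemma vanishing_cong:
  "f \<in> \<O> k \<Longrightarrow> \<forall>\<^sub>F h in nhds 0. f h = g h \<Longrightarrow> g \<in> \<O> k"
  by (subst (asm) landau_o.big.in_cong)

lemma vanishing_reflect:
  fixes f :: "real ^ 'n \<Rightarrow> real"
  assumes "f \<in> \<O> k"
  shows "(\<lambda>h. f (- h)) \<in> \<O> k"
proof -
  have "filterlim uminus (nhds 0) (nhds (0 :: real ^ 'n))"
    using tendsto_minus[OF filterlim_ident[of "nhds (0 :: real ^ 'n)"]] by simp
  from landau_o.big.compose[OF assms this] show ?thesis by simp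
qed

lemma vanishing_norm: "(\<lambda>h. norm h) \<in> \<O> 1"
  by (rule vanishing_leI[of _ 1]) simp

lemma vanishing_inner: "(\<lambda>h. x \<bullet> h) \<in> \<O> 1"
  by (rule vanishing_leI[of _ "norm x"]) (simp add: Cauchy_Schwarz_ineq2)

lemma vanishing_inner_self: "(\<lambda>h. h \<bullet> h) \<in> \<O> 2"
  by (rule vanishing_leI[of _ 1]) (simp add: power2_norm_eq_inner)

lemma vanishing_component: "(\<lambda>h. h $ e) \<in> \<O> 1"
  by (rule vanishing_leI[of _ 1]) (simp add: component_le_norm_cart)

lemma vanishing_unit_vec:
  fixes F :: "real ^ 'n \<Rightarrow> real"
  assumes "continuous_on UNIV F"
  shows "(\<lambda>h. F (unit_vec h)) \<in> \<O> 0"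
proof -
  obtain C where "\<And>h. \<bar>F (unit_vec h)\<bar> \<le> C"
    using continuous_unit_vec_bounded[OF assms] by blast
  then show ?thesis by (intro vanishing_leI[of _ C]) simp
qed

text \<open>For |t| <= 1/2 the base 1 + t stays away from 0, so the third derivative is bounded by
  compactness and Lagrange's remainder applies. \<open>D m\<close> is the m-th derivative, with its
  falling factorial.\<close>

lemma powr_taylor2:
  fixes a :: real
  obtains C where "\<And>t. \<bar>t\<bar> \<le> 1 / 2 \<Longrightarrow>
    \<bar>(1 + t) powr a - 1 - a * t - a * (a - 1) / 2 * t\<^sup>2\<bar> \<le> C * \<bar>t\<bar> ^ 3"
proof -
  define D where "D m t = (\<Prod>i<m. a - real i) * (1 + t) powr (a - real m)" for m :: nat and t :: real
  have deriv: "(D m has_real_derivative D (Suc m) t) (at t)" if "\<bar>t\<bar> \<le> 1 / 2" for m t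
    unfolding D_def using that
    by (auto intro!: derivative_eq_intros simp: algebra_simps)
  define f where "f t = (1 + t) powr (a - 3)" for t :: real
  have "continuous_on {-1/2..1/2} f"
    unfolding f_def by (intro continuous_intros) auto
  then have "bounded (f ` {-1/2..1/2})"
    by (intro compact_imp_bounded compact_continuous_image) auto
  then obtain B where B: "\<And>t. \<bar>t\<bar> \<le> 1 / 2 \<Longrightarrow> \<bar>f t\<bar> \<le> B"
    unfolding bounded_iff by (force simp: abs_le_iff)
  show ?thesis
  proof (rule that)
    fix t :: real assume t: "\<bar>t\<bar> \<le> 1 / 2"
    show "\<bar>(1 + t) powr a - 1 - a * t - a * (a - 1) / 2 * t\<^sup>2\<bar> \<le> (\<bar>a * (a - 1) * (a - 2)\<bar> / 6 * B) * \<bar>t\<bar> ^ 3"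
    proof (cases "t = 0")
      case False
      have "\<exists>s. (if t < 0 then t < s \<and> s < 0 else 0 < s \<and> s < t) \<and>
          D 0 t = (\<Sum>m<3. D m 0 / fact m * (t - 0) ^ m) + D 3 s / fact 3 * (t - 0) ^ 3"
        by (rule Taylor[of 3 D "D 0" "-1/2" "1/2"]) (use t False deriv in \<open>auto simp: abs_le_iff\<close>)
      then obtain s where s0: "if t < 0 then t < s \<and> s < 0 else 0 < s \<and> s < t"
        and eq: "D 0 t = (\<Sum>m<3. D m 0 / fact m * t ^ m) + D 3 s / fact 3 * t ^ 3"
        unfolding diff_zero by blast
      have s: "\<bar>s\<bar> \<le> 1 / 2" using s0 t by (auto split: if_splits)
      have "(1 + t) powr a - 1 - a * t - a * (a - 1) / 2 * t\<^sup>2 = D 3 s / 6 * t ^ 3"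
        using eq by (simp add: D_def eval_nat_numeral lessThan_Suc)
      also have "\<bar>\<dots>\<bar> = (\<bar>a * (a - 1) * (a - 2)\<bar> / 6 * \<bar>f s\<bar>) * \<bar>t\<bar> ^ 3"
        by (simp add: D_def f_def abs_mult eval_nat_numeral lessThan_Suc)
      also have "\<dots> \<le> (\<bar>a * (a - 1) * (a - 2)\<bar> / 6 * B) * \<bar>t\<bar> ^ 3"
        using B[OF s] by (intro mult_right_mono mult_left_mono) auto
      finally show ?thesis .
    qed simp
  qed
qed

section \<open>Taylor coefficients of u and of the squared cosine\<close>

definition u_lin :: "'n \<Rightarrow> real \<Rightarrow> real ^ 'n \<Rightarrow> real ^ 'n \<Rightarrow> real"
  where "u_lin e \<delta> x h = norm x powr (- \<delta>) * (h $ e - \<delta> / (norm x)\<^sup>2 * x $ e * (x \<bullet> h))"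

text \<open>Half the Hessian form of u at x, just as \<open>u_lin\<close> is the gradient paired
  with h.\<close>

definition u_quad :: "'n \<Rightarrow> real \<Rightarrow> real ^ 'n \<Rightarrow> real ^ 'n \<Rightarrow> real"
  where "u_quad e \<delta> x h = norm x powr (- \<delta>) *
    (\<delta> * (\<delta> + 2) / (2 * (norm x) ^ 4) * x $ e * (x \<bullet> h)\<^sup>2
      - \<delta> / (2 * (norm x)\<^sup>2) * x $ e * (h \<bullet> h) - \<delta> / (norm x)\<^sup>2 * (x \<bullet> h) * h $ e)"

text \<open>For a unit vector w, the derivative at t = 0 of ((x + t w).w)^2 / |x + t w|^2.\<close>

definition cos_lin :: "real ^ 'n \<Rightarrow> real ^ 'n \<Rightarrow> real"
  where "cos_lin x w = 2 / (norm x)\<^sup>2 * (x \<bullet> w) - 2 / (norm x) ^ 4 * (x \<bullet> w) ^ 3"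

text \<open>The relative increment of the squared norm from x to x + h. Both expansions reduce to
  powers of 1 plus this quantity.\<close>

definition rel_incr :: "real ^ 'n \<Rightarrow> real ^ 'n \<Rightarrow> real"
  where "rel_incr x h = (2 * (x \<bullet> h) + h \<bullet> h) / (norm x)\<^sup>2"

lemma norm_add_rel_incr:
  assumes "x \<noteq> 0"
  shows "(norm (x + h))\<^sup>2 = (norm x)\<^sup>2 * (1 + rel_incr x h)"
proof -
  have "(norm x)\<^sup>2 * rel_incr x h = 2 * (x \<bullet> h) + h \<bullet> h"
    using assms unfolding rel_incr_def by (metis nonzero_mult_div_cancel_left norm_eq_zero power_not_zero times_divide_eq_right)
  then have "(norm x)\<^sup>2 * (1 + rel_incr x h) = (norm x)\<^sup>2 + (2 * (x \<bullet> h) + h \<bullet> h)"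
    by (simp only: distrib_left mult_1_right)
  then show ?thesis
    by (simp add: power2_norm_eq_inner inner_add_left inner_add_right inner_commute[of h x])
qed

lemma vanishing_rel_incr: "rel_incr x \<in> \<O> 1"
proof -
  have "(\<lambda>h. (1 / (norm x)\<^sup>2) * (2 * (x \<bullet> h) + h \<bullet> h)) \<in> \<O> 1"
    by (intro vanishing_cmult vanishing_add vanishing_inner vanishing_weaken[OF vanishing_inner_self]) simp
  then show ?thesis by (simp add: rel_incr_def[abs_def])
qed

lemma eventually_rel_incr_small:
  fixes x :: "real ^ 'n"
  shows "\<forall>\<^sub>F h in nhds 0. \<bar>rel_incr x h\<bar> \<le> 1 / 2"
proof -
  have "(rel_incr x \<longlongrightarrow> (2 * (x \<bullet> 0) + (0 :: real ^ 'n) \<bullet> 0) / (norm x)\<^sup>2) (nhds 0)"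
    unfolding rel_incr_def divide_inverse
    by (intro tendsto_mult tendsto_add tendsto_const tendsto_inner[OF filterlim_ident filterlim_ident]
        tendsto_inner[OF tendsto_const filterlim_ident])
  then have "(rel_incr x \<longlongrightarrow> 0) (nhds 0)" by simp
  from tendstoD[OF this, of "1/2"] show ?thesis
    by (simp add: eventually_mono)
qed

lemma vanishing_powr_remainder:
  "(\<lambda>h. (1 + rel_incr x h) powr a - 1 - a * rel_incr x h - a * (a - 1) / 2 * (rel_incr x h)\<^sup>2) \<in> \<O> 3"
proof -
  obtain C where C: "\<And>t. \<bar>t\<bar> \<le> 1 / 2 \<Longrightarrow>
      \<bar>(1 + t) powr a - 1 - a * t - a * (a - 1) / 2 * t\<^sup>2\<bar> \<le> C * \<bar>t\<bar> ^ 3"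
    using powr_taylor2 by blast
  have "(\<lambda>h. (1 + rel_incr x h) powr a - 1 - a * rel_incr x h - a * (a - 1) / 2 * (rel_incr x h)\<^sup>2)
      \<in> O[nhds 0](\<lambda>h. rel_incr x h ^ 3)"
    by (rule bigoI[of _ C], use eventually_rel_incr_small[of x] in eventually_elim)
       (use C in \<open>simp add: power_abs\<close>)
  moreover have "(\<lambda>h. rel_incr x h ^ 3) \<in> \<O> 3"
    using landau_o.big_power[OF vanishing_rel_incr, of x 3] by simp
  ultimately show ?thesis by (rule landau_o.big.trans)
qed

text \<open>The weight becomes \<open>norm x powr (- \<delta>)\<close> times the power a = -delta/2
  of 1 plus the relative increment, so the one-variable Taylor formula applies.\<close>

lemma u_fun_expand:
  fixes x :: "real ^ 'n"
  assumes x: "x \<noteq> 0"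
  shows "(\<lambda>h. u_fun e \<delta> (x + h) - u_fun e \<delta> x - u_lin e \<delta> x h - u_quad e \<delta> x h) \<in> \<O> 3"
proof -
  define a where "a = - \<delta> / 2"
  define \<rho> where "\<rho> = norm x"
  let ?w = "rel_incr x"
  let ?R = "\<lambda>h. (1 + ?w h) powr a - 1 - a * ?w h - a * (a - 1) / 2 * (?w h)\<^sup>2"
  \<comment> \<open>The terms of degree three and more that remain when the second order Taylor
    polynomial is multiplied by the component of x + h and the parts \<open>u_lin\<close> and
    \<open>u_quad\<close> are removed.\<close>
  let ?P = "\<lambda>h. a / \<rho>\<^sup>2 * ((h \<bullet> h) * h $ e)
      + a * (a - 1) / 2 * (x $ e / \<rho> ^ 4 * (4 * ((x \<bullet> h) * (h \<bullet> h)) + (h \<bullet> h) * (h \<bullet> h)) + ?w h * (?w h * h $ e))"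
  have \<rho>: "\<rho> > 0" using x by (simp add: \<rho>_def)
  have p: "norm (x + h) powr (- \<delta>) = \<rho> powr (- \<delta>) * (1 + ?w h) powr a" for h
  proof -
    have nn: "1 + ?w h \<ge> 0"
      using norm_add_rel_incr[OF x, of h] x by (smt (verit) zero_le_mult_iff zero_le_power2 zero_less_norm_iff zero_less_power)
    have "norm (x + h) powr (- \<delta>) = ((norm (x + h))\<^sup>2) powr a"
      by (simp add: a_def powr_powr flip: powr_numeral)
    also have "\<dots> = (\<rho>\<^sup>2) powr a * (1 + ?w h) powr a"
      unfolding norm_add_rel_incr[OF x] \<rho>_def using nn by (simp add: powr_mult)
    also have "(\<rho>\<^sup>2) powr a = \<rho> powr (- \<delta>)"
      using \<rho> by (simp add: a_def powr_powr flip: powr_numeral)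
    finally show ?thesis .
  qed
  have "u_fun e \<delta> (x + h) - u_fun e \<delta> x - u_lin e \<delta> x h - u_quad e \<delta> x h =
      \<rho> powr (- \<delta>) * (?R h * (x $ e + h $ e) + ?P h)" for h
  proof -
    have d: "\<delta> = - 2 * a" by (simp add: a_def)
    have w: "?w h = (2 * (x \<bullet> h) + h \<bullet> h) / \<rho>\<^sup>2" by (simp add: rel_incr_def \<rho>_def)
    have "u_fun e \<delta> (x + h) - u_fun e \<delta> x - u_lin e \<delta> x h - u_quad e \<delta> x h = \<rho> powr (- \<delta>) *
      ((1 + ?w h) powr a * (x $ e + h $ e) - x $ e - (h $ e - \<delta> / \<rho>\<^sup>2 * x $ e * (x \<bullet> h))
        - (\<delta> * (\<delta> + 2) / (2 * \<rho> ^ 4) * x $ e * (x \<bullet> h)\<^sup>2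
          - \<delta> / (2 * \<rho>\<^sup>2) * x $ e * (h \<bullet> h) - \<delta> / \<rho>\<^sup>2 * (x \<bullet> h) * h $ e))"
      unfolding u_fun_eq p u_lin_def u_quad_def \<rho>_def[symmetric]
      by (simp only: right_diff_distrib mult.assoc vector_add_component)
    also have "(1 + ?w h) powr a * (x $ e + h $ e) - x $ e - (h $ e - \<delta> / \<rho>\<^sup>2 * x $ e * (x \<bullet> h))
        - (\<delta> * (\<delta> + 2) / (2 * \<rho> ^ 4) * x $ e * (x \<bullet> h)\<^sup>2
          - \<delta> / (2 * \<rho>\<^sup>2) * x $ e * (h \<bullet> h) - \<delta> / \<rho>\<^sup>2 * (x \<bullet> h) * h $ e)
        = ?R h * (x $ e + h $ e) + ?P h"
      unfolding d w using \<rho> by (simp add: field_simps) algebra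
    finally show ?thesis .
  qed
  moreover have "(\<lambda>h. \<rho> powr (- \<delta>) * (?R h * (x $ e + h $ e) + ?P h)) \<in> \<O> 3"
    by (intro vanishing_cmult vanishing_add
        vanishing_mult[OF vanishing_powr_remainder vanishing_add[OF vanishing_const vanishing_weaken[OF vanishing_component]]]
        vanishing_mult[OF vanishing_inner_self vanishing_component]
        vanishing_mult[OF vanishing_inner vanishing_inner_self]
        vanishing_mult[OF vanishing_inner_self vanishing_inner_self]
        vanishing_mult[OF vanishing_rel_incr vanishing_mult[OF vanishing_rel_incr vanishing_component order_refl]]) simp_all
  ultimately show ?thesis by simp
qed

lemma cos_sq_eq: "cos_sq y h = (y \<bullet> unit_vec h)\<^sup>2 / (norm y)\<^sup>2"
  unfolding cos_sq_def unit_vec_def[of y] by (simp add: power_mult_distrib power_inverse divide_inverse)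

text \<open>The squared cosine depends on the direction of h and is not smooth at 0, so the
  coefficients are bounded functions of \<open>unit_vec h\<close>. Second order accuracy suffices,
  since the error is multiplied by a difference of u, itself of first order.\<close>

lemma cos_sq_expand:
  fixes x :: "real ^ 'n"
  assumes x: "x \<noteq> 0"
  shows "(\<lambda>h. cos_sq (x + h) h - cos_sq x h - norm h * cos_lin x (unit_vec h)) \<in> \<O> 2"
proof -
  define \<rho> where "\<rho> = norm x"
  have \<rho>: "\<rho> > 0" using x by (simp add: \<rho>_def)
  let ?w = "rel_incr x" and ?B = "\<lambda>h. x \<bullet> unit_vec h"
  \<comment> \<open>The exact identity 1/(1 + w) = 1 - w + w^2/(1 + w) is inserted; every summand
    here has order at least two. The first order part of w produces the cubic term of
    \<open>cos_lin\<close>.\<close>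
  let ?E = "\<lambda>h. (1 / \<rho>\<^sup>2) * (((?B h + norm h) * (?B h + norm h)) * (?w h * (?w h * inverse (1 + ?w h)))
      - (2 * (?B h * (norm h * ?w h)) + (h \<bullet> h) * ?w h) + h \<bullet> h - (1 / \<rho>\<^sup>2) * ((?B h * ?B h) * (h \<bullet> h)))"
  have "\<forall>\<^sub>F h in nhds 0. ?E h = cos_sq (x + h) h - cos_sq x h - norm h * cos_lin x (unit_vec h)"
    using eventually_rel_incr_small[of x]
  proof eventually_elim
    case (elim h)
    then have w1: "1 + ?w h \<noteq> 0" by auto
    have bh: "x \<bullet> h = norm h * ?B h" and hh: "h \<bullet> unit_vec h = norm h" and n: "h \<bullet> h = norm h * norm h"
      by (cases "h = 0"; simp add: unit_vec_def dot_square_norm power2_eq_square)+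
    have "cos_sq (x + h) h = (?B h + norm h)\<^sup>2 / (\<rho>\<^sup>2 * (1 + ?w h))"
      unfolding cos_sq_eq norm_add_rel_incr[OF x] \<rho>_def by (simp add: inner_add_left hh)
    also have "\<dots> = (1 / \<rho>\<^sup>2) * (?B h + norm h)\<^sup>2 * (1 - ?w h + ?w h * (?w h * inverse (1 + ?w h)))"
      using w1 \<rho> by (simp add: divide_simps) algebra
    finally have c: "cos_sq (x + h) h = \<dots>" .
    have w: "?B h * ?B h * ?w h = ?B h * ?B h * (2 * (norm h * ?B h) + norm h * norm h) / \<rho>\<^sup>2"
      by (simp add: rel_incr_def \<rho>_def bh n)
    have "?E h = (1 / \<rho>\<^sup>2) * (?B h + norm h)\<^sup>2 * (1 - ?w h + ?w h * (?w h * inverse (1 + ?w h)))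
        - (1 / \<rho>\<^sup>2) * (?B h * ?B h) - (1 / \<rho>\<^sup>2) * (2 * ?B h * norm h)
        + (1 / \<rho>\<^sup>2) * (?B h * ?B h * ?w h - (1 / \<rho>\<^sup>2) * (?B h * ?B h) * (norm h * norm h))"
      unfolding n by (simp add: power2_eq_square algebra_simps)
    also have "\<dots> = cos_sq (x + h) h - cos_sq x h - norm h * cos_lin x (unit_vec h)"
      unfolding c w cos_sq_eq[of x] cos_lin_def \<rho>_def[symmetric]
      using \<rho> by (simp add: field_simps power2_eq_square power3_eq_cube power4_eq_xxxx)
    finally show ?case .
  qed
  moreover have "?E \<in> \<O> 2"
  proof -
    have B: "?B \<in> \<O> 0"
      by (rule vanishing_unit_vec) (intro continuous_intros)
    have Bn: "(\<lambda>h. ?B h + norm h) \<in> \<O> 0"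
      by (intro vanishing_add B vanishing_weaken[OF vanishing_norm]) simp
    have inv: "(\<lambda>h. inverse (1 + ?w h)) \<in> \<O> 0"
    proof (rule bigoI[of _ 2], use eventually_rel_incr_small[of x] in eventually_elim)
      fix h assume "\<bar>?w h\<bar> \<le> 1 / 2"
      then have "1 + ?w h \<ge> 1 / 2" by linarith
      then show "norm (inverse (1 + ?w h)) \<le> 2 * norm (norm h ^ 0)"
        using le_imp_inverse_le[of "1/2" "1 + ?w h"] by simp
    qed
    show ?thesis
      by (intro vanishing_cmult vanishing_add vanishing_diff vanishing_inner_self
        vanishing_mult[OF vanishing_mult[OF Bn Bn order_refl]
          vanishing_mult[OF vanishing_rel_incr vanishing_mult[OF vanishing_rel_incr inv order_refl] order_refl]]
        vanishing_mult[OF B vanishing_mult[OF vanishing_norm vanishing_rel_incr order_refl]]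
        vanishing_mult[OF vanishing_inner_self vanishing_rel_incr]
        vanishing_mult[OF vanishing_mult[OF B B order_refl] vanishing_inner_self]) simp_all
  qed
  ultimately show ?thesis by (rule vanishing_cong[rotated])
qed

section \<open>Symmetrization and the limit\<close>

lemma singular_integral:
  fixes N F :: "real ^ 'n \<Rightarrow> real"
  assumes N: "N \<in> borel_measurable borel" and F: "continuous_on UNIV F"
    and bound: "\<And>h. \<bar>N h\<bar> \<le> B"
    and expand: "(\<lambda>h. N h - (norm h)\<^sup>2 * F (unit_vec h)) \<in> \<O> 3"
  shows singular_integrable:
      "s \<in> {0<..<1} \<Longrightarrow> integrable lborel (\<lambda>h. norm h powr (- real CARD('n) - 2 * s) * N h)"
    and singular_limit:
      "((\<lambda>s. (1 - s) * (LINT h|lborel. norm h powr (- real CARD('n) - 2 * s) * N h)) \<longlongrightarrow>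
        real CARD('n) / 2 * sphere_moment F) (at_left 1)"
proof -
  obtain c where "c > 0" and ev: "\<forall>\<^sub>F h in nhds 0. norm (N h - (norm h)\<^sup>2 * F (unit_vec h)) \<le> c * norm (norm h ^ 3)"
    using expand by (rule landau_o.bigE)
  from ev obtain d where d: "d > 0"
    "\<And>h. dist h 0 < d \<Longrightarrow> norm (N h - (norm h)\<^sup>2 * F (unit_vec h)) \<le> c * norm (norm h ^ 3)"
    unfolding eventually_nhds_metric by blast
  \<comment> \<open>A single constant has to serve both the global bound and the cubic
    error.\<close>
  define C where "C = max B c"
  \<comment> \<open>Half the radius, because the expansion is required on a closed ball.\<close>
  have 1: "d / 2 > 0" using d by simp
  have 2: "\<bar>N h\<bar> \<le> C" for h using bound[of h] by (simp add: C_def)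
  have 3: "\<bar>N h - (norm h)\<^sup>2 * F (unit_vec h)\<bar> \<le> C * norm h ^ 3" if "norm h \<le> d / 2" for h
  proof -
    have "\<bar>N h - (norm h)\<^sup>2 * F (unit_vec h)\<bar> \<le> c * norm h ^ 3"
      using d that by simp
    also have "\<dots> \<le> C * norm h ^ 3" by (intro mult_right_mono) (simp_all add: C_def)
    finally show ?thesis .
  qed
  show "s \<in> {0<..<1} \<Longrightarrow> integrable lborel (\<lambda>h. norm h powr (- real CARD('n) - 2 * s) * N h)"
    by (rule singular_integral_estimate(1)[OF N F 1 2 3])
  show "((\<lambda>s. (1 - s) * (LINT h|lborel. norm h powr (- real CARD('n) - 2 * s) * N h)) \<longlongrightarrow>
        real CARD('n) / 2 * sphere_moment F) (at_left 1)"
    by (rule singular_integral_tendsto[OF N F 1 2 3])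
qed

section \<open>Symmetrized differences and their quadratic parts\<close>

definition isotropic_difference :: "'n \<Rightarrow> real \<Rightarrow> real ^ 'n \<Rightarrow> real ^ 'n \<Rightarrow> real"
  where "isotropic_difference e \<delta> x h = 2 * u_fun e \<delta> x - u_fun e \<delta> (x + h) - u_fun e \<delta> (x - h)"

text \<open>The weight at x is common to h and -h and multiplies the full second difference; the
  weights at x + h and x - h differ. The factor 1/2 is the averaging of the matrix over two
  endpoints.\<close>

definition radial_difference :: "'n \<Rightarrow> real \<Rightarrow> real ^ 'n \<Rightarrow> real ^ 'n \<Rightarrow> real"
  where "radial_difference e \<delta> x h = (cos_sq x h * isotropic_difference e \<delta> x h
    + cos_sq (x + h) h * (u_fun e \<delta> x - u_fun e \<delta> (x + h))
    + cos_sq (x - h) h * (u_fun e \<delta> x - u_fun e \<delta> (x - h))) / 2"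

definition isotropic_quad :: "'n \<Rightarrow> real \<Rightarrow> real ^ 'n \<Rightarrow> real ^ 'n \<Rightarrow> real"
  where "isotropic_quad e \<delta> x w = - 2 * u_quad e \<delta> x w"

text \<open>The product \<open>cos_lin\<close> times \<open>u_lin\<close> is the interaction of two
  odd first order parts; it carries the derivative of the coefficient matrix into the limit.\<close>

definition radial_quad :: "'n \<Rightarrow> real \<Rightarrow> real ^ 'n \<Rightarrow> real ^ 'n \<Rightarrow> real"
  where "radial_quad e \<delta> x w = - 2 * ((x \<bullet> w)\<^sup>2 / (norm x)\<^sup>2) * u_quad e \<delta> x w - cos_lin x w * u_lin e \<delta> x w"

lemma isotropic_difference_measurable [measurable]:
  "isotropic_difference e \<delta> x \<in> borel_measurable borel"
  unfolding isotropic_difference_def[abs_def] by measurable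

lemma radial_difference_measurable [measurable]:
  "radial_difference e \<delta> x \<in> borel_measurable borel"
  unfolding radial_difference_def[abs_def] by measurable

lemma continuous_isotropic_quad: "continuous_on UNIV (isotropic_quad e \<delta> x)"
  unfolding isotropic_quad_def[abs_def] u_quad_def by (intro continuous_intros)

lemma continuous_radial_quad: "continuous_on UNIV (radial_quad e \<delta> x)"
  unfolding radial_quad_def[abs_def] u_quad_def u_lin_def cos_lin_def divide_inverse
  by (intro continuous_intros)

lemma isotropic_difference_bound:
  assumes "0 \<le> \<delta>" "\<delta> \<le> 1" "x \<noteq> 0"
  shows "\<bar>isotropic_difference e \<delta> x h\<bar> \<le> 6 * norm x powr (1 - \<delta>)"
  using u_fun_symmetric_sum_le[OF assms, of e h] abs_u_fun_le[of e \<delta> x]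
  unfolding isotropic_difference_def by linarith

text \<open>The weights at x + h and x - h differ, so oddness of u alone cannot cancel its growth.
  Writing cos^2 = 1 - sin^2 leaves an unweighted sum, controlled by oddness, and sine terms,
  controlled by the angle. For twice the difference the bounds are 6 + 1 + 1 + 4 + 1 + 1 =
  14.\<close>

lemma radial_difference_bound:
  assumes "0 \<le> \<delta>" "\<delta> \<le> 1" "x \<noteq> 0"
  shows "\<bar>radial_difference e \<delta> x h\<bar> \<le> 7 * norm x powr (1 - \<delta>)"
proof (cases "h = 0")
  case False
  let ?u = "u_fun e \<delta>" and ?P = "norm x powr (1 - \<delta>)"
  have c: "\<bar>cos_sq y h * r\<bar> \<le> B" if "\<bar>r\<bar> \<le> B" for y r B
    using that cos_sq_bounds[of y h] mult_left_le_one_le[of "\<bar>r\<bar>" "cos_sq y h"] by (simp add: abs_mult)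
  have "\<bar>(1 - cos_sq (x + h) h) * ?u (x + h)\<bar> \<le> ?P"
    using False by (intro sin_sq_u_fun_le assms)
  moreover have "\<bar>(1 - cos_sq (x - h) h) * ?u (x - h)\<bar> \<le> ?P"
    using sin_sq_u_fun_le[OF assms, of "- h" e] False by simp
  moreover have "2 * radial_difference e \<delta> x h = cos_sq x h * isotropic_difference e \<delta> x h
      + cos_sq (x + h) h * ?u x + cos_sq (x - h) h * ?u x - (?u (x + h) + ?u (x - h))
      + (1 - cos_sq (x + h) h) * ?u (x + h) + (1 - cos_sq (x - h) h) * ?u (x - h)"
  proof -
    have "2 * radial_difference e \<delta> x h = cos_sq x h * isotropic_difference e \<delta> x h
        + cos_sq (x + h) h * (?u x - ?u (x + h)) + cos_sq (x - h) h * (?u x - ?u (x - h))"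
      by (simp add: radial_difference_def)
    then show ?thesis by (simp add: algebra_simps)
  qed
  ultimately show ?thesis
    using c[OF isotropic_difference_bound[OF assms, of e h], of x]
      c[OF abs_u_fun_le[of e \<delta> x], of "x + h"] c[OF abs_u_fun_le[of e \<delta> x], of "x - h"]
      u_fun_symmetric_sum_le[OF assms, of e h]
    unfolding abs_le_iff by linarith
qed (simp add: radial_difference_def isotropic_difference_def)

lemma norm_scaleR_unit_vec: "norm h *\<^sub>R unit_vec h = h"
  by (cases "h = 0") (simp_all add: unit_vec_def)

lemma u_lin_scaleR: "u_lin e \<delta> x (c *\<^sub>R w) = c * u_lin e \<delta> x w"
  by (simp add: u_lin_def algebra_simps)

lemma u_quad_scaleR: "u_quad e \<delta> x (c *\<^sub>R w) = c\<^sup>2 * u_quad e \<delta> x w"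
  by (simp add: u_quad_def algebra_simps power2_eq_square)

lemma u_lin_unit_vec: "norm h * u_lin e \<delta> x (unit_vec h) = u_lin e \<delta> x h"
  by (simp only: u_lin_scaleR[symmetric] norm_scaleR_unit_vec)

lemma u_quad_unit_vec: "(norm h)\<^sup>2 * u_quad e \<delta> x (unit_vec h) = u_quad e \<delta> x h"
  by (simp only: u_quad_scaleR[symmetric] norm_scaleR_unit_vec)

lemma u_lin_minus: "u_lin e \<delta> x (- h) = - u_lin e \<delta> x h"
  using u_lin_scaleR[of e \<delta> x "-1" h] by simp

lemma u_quad_minus: "u_quad e \<delta> x (- h) = u_quad e \<delta> x h"
  using u_quad_scaleR[of e \<delta> x "-1" h] by simp

lemma unit_vec_minus: "unit_vec (- h) = - unit_vec h"
  by (simp add: unit_vec_def)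

lemma isotropic_difference_expand:
  fixes x :: "real ^ 'n"
  assumes x: "x \<noteq> 0"
  shows "(\<lambda>h. isotropic_difference e \<delta> x h - (norm h)\<^sup>2 * isotropic_quad e \<delta> x (unit_vec h)) \<in> \<O> 3"
proof -
  let ?r = "\<lambda>h. u_fun e \<delta> (x + h) - u_fun e \<delta> x - u_lin e \<delta> x h - u_quad e \<delta> x h"
  have "isotropic_difference e \<delta> x h - (norm h)\<^sup>2 * isotropic_quad e \<delta> x (unit_vec h) = (- 1) * (?r h + ?r (- h))" for h
  proof -
    have "(norm h)\<^sup>2 * isotropic_quad e \<delta> x (unit_vec h) = - 2 * u_quad e \<delta> x h"
      unfolding isotropic_quad_def u_quad_unit_vec[of h, symmetric] by simp
    then show ?thesis
      by (simp add: isotropic_difference_def u_lin_minus u_quad_minus)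
  qed
  moreover have "(\<lambda>h. (- 1) * (?r h + ?r (- h))) \<in> \<O> 3"
    by (intro vanishing_cmult vanishing_add u_fun_expand[OF x] vanishing_reflect[OF u_fun_expand[OF x]])
  ultimately show ?thesis by (simp only:)
qed

text \<open>Up to third order, p and \<open>u_lin\<close> are odd, \<open>u_quad\<close> and the
  weight at x even. Reflection therefore cancels p times \<open>u_quad\<close> and keeps p times
  \<open>u_lin\<close>.\<close>

lemma radial_difference_expand:
  fixes x :: "real ^ 'n"
  assumes x: "x \<noteq> 0"
  shows "(\<lambda>h. radial_difference e \<delta> x h - (norm h)\<^sup>2 * radial_quad e \<delta> x (unit_vec h)) \<in> \<O> 3"
proof -
  let ?u = "u_fun e \<delta>" and ?l = "u_lin e \<delta> x" and ?q = "u_quad e \<delta> x"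
  define r where "r h = ?u (x + h) - ?u x - ?l h - ?q h" for h
  define c where "c h = cos_sq (x + h) h - cos_sq x h - norm h * cos_lin x (unit_vec h)" for h
  define d where "d h = isotropic_difference e \<delta> x h - (norm h)\<^sup>2 * isotropic_quad e \<delta> x (unit_vec h)" for h
  define p where "p h = norm h * cos_lin x (unit_vec h)" for h
  have r: "r \<in> \<O> 3" unfolding r_def[abs_def] by (rule u_fun_expand[OF x])
  have c: "c \<in> \<O> 2" unfolding c_def[abs_def] by (rule cos_sq_expand[OF x])
  have d: "d \<in> \<O> 3" unfolding d_def[abs_def] by (rule isotropic_difference_expand[OF x])
  have r': "(\<lambda>h. r (- h)) \<in> \<O> 3" and c': "(\<lambda>h. c (- h)) \<in> \<O> 2"
    using r c by (auto intro: vanishing_reflect)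
  have p: "p \<in> \<O> 1"
    unfolding p_def[abs_def]
    by (rule vanishing_mult[OF vanishing_norm vanishing_unit_vec])
       (use x in \<open>auto simp: cos_lin_def[abs_def] intro!: continuous_intros\<close>)
  have "(\<lambda>h. (norm h)\<^sup>2 * ?q (unit_vec h)) \<in> \<O> 2"
    by (rule vanishing_mult[OF vanishing_leI[of _ 1] vanishing_unit_vec])
       (use x in \<open>auto simp: u_quad_def[abs_def] intro!: continuous_intros\<close>)
  then have q: "?q \<in> \<O> 2" by (simp only: u_quad_unit_vec)
  have "(\<lambda>h. norm h * ?l (unit_vec h)) \<in> \<O> 1"
    by (rule vanishing_mult[OF vanishing_norm vanishing_unit_vec])
       (use x in \<open>auto simp: u_lin_def[abs_def] intro!: continuous_intros\<close>)
  then have l: "?l \<in> \<O> 1" by (simp only: u_lin_unit_vec)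
  have k: "cos_sq x \<in> \<O> 0"
    by (rule vanishing_leI[of _ 1]) (simp add: abs_of_nonneg cos_sq_bounds)
  \<comment> \<open>Each product pairs remainders of complementary orders: c is of order two only,
    but always meets a factor of order one.\<close>
  let ?E = "\<lambda>h. (1 / 2) * (cos_sq x h * (d h - r h - r (- h)) + p h * (r (- h) - r h)
      - c h * (?l h + ?q h + r h) + c (- h) * (?l h - ?q h - r (- h)))"
  have "radial_difference e \<delta> x h - (norm h)\<^sup>2 * radial_quad e \<delta> x (unit_vec h) = ?E h" for h
  proof -
    have "cos_lin x (- w) = - cos_lin x w" for w by (simp add: cos_lin_def)
    then have pm: "p (- h) = - p h" by (simp add: p_def unit_vec_minus)
    note qn = u_quad_unit_vec[of h e \<delta> x] and ln = u_lin_unit_vec[of h e \<delta> x]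
    have "(norm h)\<^sup>2 * radial_quad e \<delta> x (unit_vec h)
        = - 2 * cos_sq x h * ((norm h)\<^sup>2 * ?q (unit_vec h)) - p h * (norm h * ?l (unit_vec h))"
      unfolding radial_quad_def cos_sq_eq p_def by (simp add: power2_eq_square algebra_simps)
    then have 1: "(norm h)\<^sup>2 * radial_quad e \<delta> x (unit_vec h) = - 2 * cos_sq x h * ?q h - p h * ?l h"
      unfolding qn ln .
    have 2: "isotropic_difference e \<delta> x h = d h - 2 * ?q h"
      by (simp add: d_def isotropic_quad_def qn)
    have 3: "?u x - ?u (x + h) = - ?l h - ?q h - r h" "?u x - ?u (x - h) = ?l h - ?q h - r (- h)"
      by (simp_all add: r_def u_lin_minus u_quad_minus)
    have 4: "cos_sq (x + h) h = cos_sq x h + p h + c h" "cos_sq (x - h) h = cos_sq x h - p h + c (- h)"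
      using pm by (simp_all add: c_def p_def[symmetric]) (simp add: p_def)
    show ?thesis
      unfolding radial_difference_def 1 2 3 4 by (simp add: field_simps)
  qed
  moreover have "?E \<in> \<O> 3"
    by (intro vanishing_cmult vanishing_add vanishing_diff
        vanishing_mult[OF k vanishing_diff[OF vanishing_diff[OF d r] r']]
        vanishing_mult[OF p vanishing_diff[OF r' r]]
        vanishing_mult[OF c vanishing_add[OF vanishing_add[OF l vanishing_weaken[OF q]] vanishing_weaken[OF r]]]
        vanishing_mult[OF c' vanishing_diff[OF vanishing_diff[OF l vanishing_weaken[OF q]] vanishing_weaken[OF r']]])
      simp_all
  ultimately show ?thesis by (simp only:)
qed

text \<open>Averaging a quadratic form gives its trace over n, so this is the ball volume over n
  times minus the Laplacian of u, in accordance with \<open>local_op_u_fun\<close> at eps =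
  0.\<close>

lemma sphere_moment_isotropic_quad:
  fixes x :: "real ^ 'n"
  assumes x: "x \<noteq> 0"
  shows "sphere_moment (isotropic_quad e \<delta> x) = norm x powr (- \<delta> - 2) * x $ e *
    (unit_ball_vol CARD('n) / CARD('n) * \<delta> * (real CARD('n) - \<delta>))"
proof -
  define P where "P = norm x powr (- \<delta> - 2)"
  define V where "V = unit_ball_vol CARD('n)"
  define n where "n = real CARD('n)"
  define \<rho> where "\<rho> = norm x"
  have \<rho>: "\<rho> > 0" and n: "n > 0" using x by (simp_all add: \<rho>_def n_def)
  have P: "\<rho> powr (- \<delta>) = P * \<rho>\<^sup>2"
    using powr_add[of "norm x" "- \<delta> - 2" 2] x by (simp add: P_def \<rho>_def)
  let ?a = "axis e (1::real) :: real ^ 'n"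
  have m2: "sphere_moment (\<lambda>w. (w \<bullet> x)\<^sup>2) = V / n * \<rho>\<^sup>2"
    and m11: "sphere_moment (\<lambda>w. (w \<bullet> x) * (w \<bullet> ?a)) = V / n * x $ e"
    unfolding sphere_moment_2 sphere_moment_11 V_def n_def \<rho>_def by (simp_all add: inner_axis)
  \<comment> \<open>The factor 1 is kept so that the term has the shape of
    \<open>sphere_moment_norm_mult\<close> with constant F.\<close>
  have cont: "continuous_on UNIV (\<lambda>w. (w \<bullet> x)\<^sup>2)" "continuous_on UNIV (\<lambda>w :: real ^ 'n. 1 * (w \<bullet> w))"
    "continuous_on UNIV (\<lambda>w. (w \<bullet> x) * (w \<bullet> ?a))"
    by (intro continuous_intros)+
  have "isotropic_quad e \<delta> x = (\<lambda>w. - P * x $ e * \<delta> * (\<delta> + 2) / \<rho>\<^sup>2 * (w \<bullet> x)\<^sup>2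
      + (P * x $ e * \<delta> * (1 * (w \<bullet> w)) + 2 * P * \<delta> * ((w \<bullet> x) * (w \<bullet> ?a))))"
    unfolding isotropic_quad_def[abs_def] u_quad_def \<rho>_def[symmetric] P inner_axis
    using \<rho> by (intro ext) (simp add: inner_commute[of x] field_simps power2_eq_square power4_eq_xxxx)
  then have "sphere_moment (isotropic_quad e \<delta> x) = - P * x $ e * \<delta> * (\<delta> + 2) / \<rho>\<^sup>2 * sphere_moment (\<lambda>w. (w \<bullet> x)\<^sup>2)
      + (P * x $ e * \<delta> * sphere_moment (\<lambda>w :: real ^ 'n. 1 * (w \<bullet> w)) + 2 * P * \<delta> * sphere_moment (\<lambda>w. (w \<bullet> x) * (w \<bullet> ?a)))"
    by (simp only: sphere_moment_add sphere_moment_cmult cont continuous_on_add continuous_on_mult_left)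
  also have "sphere_moment (\<lambda>w :: real ^ 'n. 1 * (w \<bullet> w)) = V"
    unfolding V_def sphere_moment_one[symmetric] by (rule sphere_moment_norm_mult) (intro continuous_intros)
  also have "- P * x $ e * \<delta> * (\<delta> + 2) / \<rho>\<^sup>2 * sphere_moment (\<lambda>w. (w \<bullet> x)\<^sup>2)
      + (P * x $ e * \<delta> * V + 2 * P * \<delta> * sphere_moment (\<lambda>w. (w \<bullet> x) * (w \<bullet> ?a)))
      = P * x $ e * (V / n * \<delta> * (n - \<delta>))"
    unfolding m2 m11 using \<rho> n by (simp add: field_simps)
  finally show ?thesis unfolding P_def V_def n_def .
qed

text \<open>The form is a combination of five monomials in w.x, the component of w and w.w. The
  factor w.w is replaced by 1; the other moments are of degree two or four, which brings in the
  denominator n + 2.\<close>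

lemma sphere_moment_radial_quad:
  fixes x :: "real ^ 'n"
  assumes x: "x \<noteq> 0"
  shows "sphere_moment (radial_quad e \<delta> x) = norm x powr (- \<delta> - 2) * x $ e *
    (unit_ball_vol CARD('n) / CARD('n) * (3 * \<delta> - 2 - 3 * (\<delta>\<^sup>2 + 2 * \<delta> - 2) / (real CARD('n) + 2)))"
proof -
  define P where "P = norm x powr (- \<delta> - 2)"
  define V where "V = unit_ball_vol CARD('n)"
  define n where "n = real CARD('n)"
  define \<rho> where "\<rho> = norm x"
  have \<rho>: "\<rho> > 0" and n: "n > 0" using x by (simp_all add: \<rho>_def n_def)
  have P: "\<rho> powr (- \<delta>) = P * \<rho>\<^sup>2"
    using powr_add[of "norm x" "- \<delta> - 2" 2] x by (simp add: P_def \<rho>_def)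
  let ?a = "axis e (1::real) :: real ^ 'n"
  have m2: "sphere_moment (\<lambda>w. (w \<bullet> x)\<^sup>2) = V / n * \<rho>\<^sup>2"
    and m11: "sphere_moment (\<lambda>w. (w \<bullet> x) * (w \<bullet> ?a)) = V / n * x $ e"
    and m4: "sphere_moment (\<lambda>w. (w \<bullet> x) ^ 4) = 3 * V / (n * (n + 2)) * \<rho> ^ 4"
    and m31: "sphere_moment (\<lambda>w. (w \<bullet> x) ^ 3 * (w \<bullet> ?a)) = 3 * V / (n * (n + 2)) * (\<rho>\<^sup>2 * x $ e)"
    unfolding sphere_moment_2 sphere_moment_11 sphere_moment_4 sphere_moment_31 V_def n_def \<rho>_def
    by (simp_all add: inner_axis algebra_simps)
  have cont: "continuous_on UNIV (\<lambda>w. (w \<bullet> x) ^ 4)" "continuous_on UNIV (\<lambda>w. (w \<bullet> x)\<^sup>2 * (w \<bullet> w))"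
    "continuous_on UNIV (\<lambda>w. (w \<bullet> x) ^ 3 * (w \<bullet> ?a))" "continuous_on UNIV (\<lambda>w. (w \<bullet> x) * (w \<bullet> ?a))"
    "continuous_on UNIV (\<lambda>w. (w \<bullet> x)\<^sup>2)"
    by (intro continuous_intros)+
  have "radial_quad e \<delta> x = (\<lambda>w. - P * x $ e * \<delta> * (\<delta> + 4) / \<rho> ^ 4 * (w \<bullet> x) ^ 4
      + (P * x $ e * \<delta> / \<rho>\<^sup>2 * ((w \<bullet> x)\<^sup>2 * (w \<bullet> w))
      + (2 * P * (\<delta> + 1) / \<rho>\<^sup>2 * ((w \<bullet> x) ^ 3 * (w \<bullet> ?a))
      + (- 2 * P * ((w \<bullet> x) * (w \<bullet> ?a)) + 2 * P * x $ e * \<delta> / \<rho>\<^sup>2 * (w \<bullet> x)\<^sup>2))))"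
    unfolding radial_quad_def[abs_def] u_quad_def u_lin_def cos_lin_def \<rho>_def[symmetric] P inner_axis
    using \<rho> by (intro ext) (simp add: inner_commute[of x] field_simps power2_eq_square power3_eq_cube power4_eq_xxxx)
  then have "sphere_moment (radial_quad e \<delta> x) = - P * x $ e * \<delta> * (\<delta> + 4) / \<rho> ^ 4 * sphere_moment (\<lambda>w. (w \<bullet> x) ^ 4)
      + (P * x $ e * \<delta> / \<rho>\<^sup>2 * sphere_moment (\<lambda>w. (w \<bullet> x)\<^sup>2 * (w \<bullet> w))
      + (2 * P * (\<delta> + 1) / \<rho>\<^sup>2 * sphere_moment (\<lambda>w. (w \<bullet> x) ^ 3 * (w \<bullet> ?a))
      + (- 2 * P * sphere_moment (\<lambda>w. (w \<bullet> x) * (w \<bullet> ?a)) + 2 * P * x $ e * \<delta> / \<rho>\<^sup>2 * sphere_moment (\<lambda>w. (w \<bullet> x)\<^sup>2))))"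
    by (simp only: sphere_moment_add sphere_moment_cmult cont continuous_on_add continuous_on_mult_left)
  also have "sphere_moment (\<lambda>w. (w \<bullet> x)\<^sup>2 * (w \<bullet> w)) = sphere_moment (\<lambda>w. (w \<bullet> x)\<^sup>2)"
    by (rule sphere_moment_norm_mult) (intro continuous_intros)
  also have "- P * x $ e * \<delta> * (\<delta> + 4) / \<rho> ^ 4 * sphere_moment (\<lambda>w. (w \<bullet> x) ^ 4)
      + (P * x $ e * \<delta> / \<rho>\<^sup>2 * sphere_moment (\<lambda>w. (w \<bullet> x)\<^sup>2)
      + (2 * P * (\<delta> + 1) / \<rho>\<^sup>2 * sphere_moment (\<lambda>w. (w \<bullet> x) ^ 3 * (w \<bullet> ?a))
      + (- 2 * P * sphere_moment (\<lambda>w. (w \<bullet> x) * (w \<bullet> ?a)) + 2 * P * x $ e * \<delta> / \<rho>\<^sup>2 * sphere_moment (\<lambda>w. (w \<bullet> x)\<^sup>2))))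
      = - P * x $ e * \<delta> * (\<delta> + 4) * (3 * V / (n * (n + 2))) + (P * x $ e * \<delta> * (V / n)
      + (2 * P * (\<delta> + 1) * (3 * V / (n * (n + 2)) * x $ e) + (- 2 * P * (V / n * x $ e) + 2 * P * x $ e * \<delta> * (V / n))))"
    unfolding m2 m11 m4 m31 using \<rho> by simp
  also have "\<dots> = P * x $ e * (V / n * (3 * \<delta> - 2 - 3 * (\<delta>\<^sup>2 + 2 * \<delta> - 2) / (n + 2)))"
    using n by (simp add: divide_simps) algebra
  finally show ?thesis unfolding P_def V_def n_def .
qed

section \<open>Splitting the kernel into isotropic and radial weights\<close>

lemma A_nonlocal_form:
  fixes v y :: "real ^ 'n"
  shows "(A_nonlocal s \<epsilon> y *v v) \<bullet> v =
    (1 - (1 + 2 * s) / 2 * \<epsilon>) * (v \<bullet> v) + (real CARD('n) + 2 * s) / 2 * \<epsilon> * (unit_vec y \<bullet> v)\<^sup>2"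
  by (simp add: A_nonlocal_def matrix_vector_mult_add_rdistrib outer_mult_vec scaleR_matrix_vector_assoc[symmetric]
      inner_add_left power2_eq_square mult_ac)

lemma kernel_eq:
  fixes x h :: "real ^ 'n"
  shows "kernel s \<epsilon> x (x + h) = norm h powr (- real CARD('n) - 2 * s) *
    (1 - (1 + 2 * s) / 2 * \<epsilon> + (real CARD('n) + 2 * s) / 2 * \<epsilon> * ((cos_sq x h + cos_sq (x + h) h) / 2))"
proof (cases "h = 0")
  case False
  then have ww: "unit_vec h \<bullet> unit_vec h = 1"
    by (simp add: unit_vec_def dot_square_norm power2_eq_square)
  have uv: "unit_vec (x - (x + h)) = - unit_vec h" by (simp add: unit_vec_minus)
  have half: "((1 / 2) *\<^sub>R (A + B) *v v) \<bullet> v = ((A *v v) \<bullet> v + (B *v v) \<bullet> v) / 2" for A B :: "real ^ 'n ^ 'n" and v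
    by (simp only: scaleR_matrix_vector_assoc[symmetric] matrix_vector_mult_add_rdistrib inner_scaleR_left inner_add_left)
  have alg: "(a * 1 + b * p + (a * 1 + b * q)) / 2 = a + b * ((p + q) / 2)" for a b p q :: real
    by (simp add: field_simps)
  have "norm (x - (x + h)) = norm h" by simp
  then show ?thesis
    unfolding kernel_def uv half A_nonlocal_form
    by (simp only: inner_minus_left inner_minus_right minus_minus ww power2_minus alg cos_sq_def)
\<comment> \<open>At \<open>h = 0\<close> both sides vanish, because \<open>0 powr a\<close> is
  0.\<close>
qed (simp add: kernel_def)

text \<open>The norm and the weight at x are unchanged by h -> -h, so the two kernels differ only in
  the weights at x + h and x - h.\<close>

lemma kernel_symmetrized:
  fixes x h :: "real ^ 'n"
  shows "kernel s \<epsilon> x (x + h) * (u_fun e \<delta> x - u_fun e \<delta> (x + h))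
      + kernel s \<epsilon> x (x - h) * (u_fun e \<delta> x - u_fun e \<delta> (x - h)) =
    (1 - (1 + 2 * s) / 2 * \<epsilon>) * (norm h powr (- real CARD('n) - 2 * s) * isotropic_difference e \<delta> x h)
    + (real CARD('n) + 2 * s) / 2 * \<epsilon> * (norm h powr (- real CARD('n) - 2 * s) * radial_difference e \<delta> x h)"
proof -
  have "K * (a + b * ((q + c1) / 2)) * (v - v1) + K * (a + b * ((q + c2) / 2)) * (v - v2) =
      a * (K * (2 * v - v1 - v2)) + b * (K * ((q * (2 * v - v1 - v2) + c1 * (v - v1) + c2 * (v - v2)) / 2))"
    for K a b q c1 c2 v v1 v2 :: real
    by (simp add: field_simps)
  then show ?thesis
    using kernel_eq[of s \<epsilon> x "- h"]
    by (simp only: kernel_eq[of s \<epsilon> x h] isotropic_difference_def radial_difference_def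
        cos_sq_minus norm_minus_cancel add_uminus_conv_diff)
qed

section \<open>Reflection and the principal value\<close>

lemma distr_lborel_uminus: "distr lborel borel uminus = (lborel :: (real ^ 'n) measure)"
  by (rule distr_lborel_orthogonal) (simp add: orthogonal_transformation_def linear_iff)

lemma set_integral_reflect:
  fixes G :: "real ^ 'n \<Rightarrow> real"
  assumes [measurable]: "G \<in> borel_measurable borel" "A \<in> sets borel" and A: "\<And>h. - h \<in> A \<longleftrightarrow> h \<in> A"
  shows "set_integrable lborel A G \<Longrightarrow> set_integrable lborel A (\<lambda>h. G (- h))"
    and "(LINT h : A | lborel. G (- h)) = (LINT h : A | lborel. G h)"
proof -
  have i: "indicator A (- h) = (indicator A h :: real)" for h using A by (simp add: indicator_def)
  show "(LINT h : A | lborel. G (- h)) = (LINT h : A | lborel. G h)"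
    unfolding set_lebesgue_integral_def
    by (subst (2) distr_lborel_uminus[symmetric], subst integral_distr) (simp_all add: i)
  assume "set_integrable lborel A G"
  then have "integrable (distr lborel borel uminus) (\<lambda>h. indicator A h *\<^sub>R G h)"
    unfolding set_integrable_def distr_lborel_uminus .
  then have "integrable lborel (\<lambda>h. indicator A (- h) *\<^sub>R G (- h))"
    by (subst (asm) integrable_distr_eq) simp_all
  then show "set_integrable lborel A (\<lambda>h. G (- h))"
    unfolding set_integrable_def i .
qed

text \<open>Needed to split the integral of a sum of reflected terms: on a shell each term is
  bounded on a set of finite measure, whereas on the whole space each alone may diverge.\<close>

lemma truncated_integrand_integrable:
  fixes x :: "real ^ 'n"
  assumes \<delta>: "0 \<le> \<delta>" "\<delta> \<le> 1" and s: "s > 0" and R: "R > 0"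
  shows "set_integrable lborel {h. 1 / R \<le> norm h \<and> norm h \<le> R}
    (\<lambda>h. kernel s \<epsilon> x (x + h) * (u_fun e \<delta> x - u_fun e \<delta> (x + h)))"
proof -
  let ?A = "{h :: real ^ 'n. 1 / R \<le> norm h \<and> norm h \<le> R}"
  let ?\<alpha> = "1 - (1 + 2 * s) / 2 * \<epsilon>" and ?\<beta> = "(real CARD('n) + 2 * s) / 2 * \<epsilon>"
  let ?K = "(1 / R) powr (- real CARD('n) - 2 * s) * (\<bar>?\<alpha>\<bar> + \<bar>?\<beta>\<bar>)"
  let ?U = "norm x powr (1 - \<delta>) + (norm x + R) powr (1 - \<delta>)"
  have meas: "(\<lambda>h. kernel s \<epsilon> x (x + h) * (u_fun e \<delta> x - u_fun e \<delta> (x + h))) \<in> borel_measurable borel"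
    unfolding kernel_eq by measurable
  have A: "?A \<in> sets borel" by measurable
  have fin: "emeasure lborel ?A < \<infinity>"
  proof -
    have "emeasure lborel ?A \<le> emeasure lborel (cball (0 :: real ^ 'n) R)"
      by (rule emeasure_mono) auto
    also have "\<dots> < \<infinity>" using R by (simp add: emeasure_cball)
    finally show ?thesis .
  qed
  have bound: "\<bar>kernel s \<epsilon> x (x + h) * (u_fun e \<delta> x - u_fun e \<delta> (x + h))\<bar> \<le> ?K * ?U" if h: "h \<in> ?A" for h
  proof -
    let ?c = "(cos_sq x h + cos_sq (x + h) h) / 2"
    have c: "0 \<le> ?c" "?c \<le> 1" using cos_sq_bounds[of x h] cos_sq_bounds[of "x + h" h] by auto
    have "\<bar>?\<alpha> + ?\<beta> * ?c\<bar> \<le> \<bar>?\<alpha>\<bar> + \<bar>?\<beta> * ?c\<bar>" by (rule abs_triangle_ineq)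
    also have "\<bar>?\<beta> * ?c\<bar> \<le> \<bar>?\<beta>\<bar> * 1"
      unfolding abs_mult using c by (intro mult_left_mono) auto
    finally have 1: "\<bar>?\<alpha> + ?\<beta> * ?c\<bar> \<le> \<bar>?\<alpha>\<bar> + \<bar>?\<beta>\<bar>" by simp
    have 2: "norm h powr (- real CARD('n) - 2 * s) \<le> (1 / R) powr (- real CARD('n) - 2 * s)"
      using h R s by (intro powr_mono2') auto
    have "\<bar>kernel s \<epsilon> x (x + h)\<bar> \<le> ?K"
      unfolding kernel_eq abs_mult[of "norm h powr _"]
      by (rule mult_mono) (use 2 in simp, rule 1, simp_all)
    moreover have "\<bar>u_fun e \<delta> x - u_fun e \<delta> (x + h)\<bar> \<le> ?U"
    proof -
      have "norm (x + h) \<le> norm x + R" using h norm_triangle_ineq[of x h] by auto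
      then have "norm (x + h) powr (1 - \<delta>) \<le> (norm x + R) powr (1 - \<delta>)"
        using \<delta> by (intro powr_mono2) auto
      then show ?thesis
        using abs_u_fun_le[of e \<delta> x] abs_u_fun_le[of e \<delta> "x + h"] by linarith
    qed
    ultimately show ?thesis unfolding abs_mult by (intro mult_mono) auto
  qed
  show ?thesis
    unfolding set_integrable_def
    by (rule integrableI_bounded_set[where A = ?A and B = "?K * ?U"])
       (use meas A fin bound in \<open>auto simp: indicator_def\<close>)
qed

text \<open>At finite R, reflection gives the truncated integral as half the integral of S over the
  shell; the shells exhaust the space up to the origin and |S| dominates.\<close>

lemma truncated_integral_tendsto:
  fixes x :: "real ^ 'n" and \<epsilon> \<delta> s :: real and e :: 'n
  assumes \<delta>: "0 \<le> \<delta>" "\<delta> \<le> 1" and s: "s > 0"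
  defines "S \<equiv> \<lambda>h. kernel s \<epsilon> x (x + h) * (u_fun e \<delta> x - u_fun e \<delta> (x + h))
      + kernel s \<epsilon> x (x - h) * (u_fun e \<delta> x - u_fun e \<delta> (x - h))"
  assumes S: "integrable lborel S"
  shows "(truncated_integral s \<epsilon> (u_fun e \<delta>) x \<longlongrightarrow> (LINT h|lborel. S h) / 2) at_top"
proof -
  let ?A = "\<lambda>R. {h :: real ^ 'n. 1 / R \<le> norm h \<and> norm h \<le> R}"
  let ?G = "\<lambda>h. kernel s \<epsilon> x (x + h) * (u_fun e \<delta> x - u_fun e \<delta> (x + h))"
  have A: "?A R \<in> sets borel" for R by measurable
  have meas: "?G \<in> borel_measurable borel"
    unfolding kernel_eq by measurable
  have "((\<lambda>R. LINT h|lborel. indicator (?A R) h *\<^sub>R S h) \<longlongrightarrow> (LINT h|lborel. S h)) at_top"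
  proof (rule integral_dominated_convergence_at_top[where w = "\<lambda>h. norm (S h)"])
    show "AE h in lborel. ((\<lambda>R. indicator (?A R) h *\<^sub>R S h) \<longlongrightarrow> S h) at_top"
      using AE_lborel_neq[of "0 :: real ^ 'n"]
    proof eventually_elim
      case (elim h)
      \<comment> \<open>Beyond both |h| and 1/|h| the shell contains h, so the truncated integrand
        is eventually constant in R.\<close>
      have "\<forall>\<^sub>F R in at_top. indicator (?A R) h *\<^sub>R S h = S h"
        using eventually_ge_at_top[of "max (norm h) (1 / norm h)"]
      proof eventually_elim
        case (elim R)
        then have "R > 0" using \<open>h \<noteq> 0\<close> by (auto intro: less_le_trans[of 0 "norm h"])
        with elim have "h \<in> ?A R" using \<open>h \<noteq> 0\<close> by (auto simp: field_simps)
        then show ?case by simp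
      qed
      then show ?case by (rule tendsto_eventually)
    qed
    show "\<forall>\<^sub>F R in at_top. AE h in lborel. norm (indicator (?A R) h *\<^sub>R S h) \<le> norm (S h)"
      by (intro always_eventually allI AE_I2) (simp add: indicator_def)
  qed (use S A in \<open>auto intro: borel_measurable_integrable\<close>)
  then have "((\<lambda>R. (LINT h|lborel. indicator (?A R) h *\<^sub>R S h) / 2) \<longlongrightarrow> (LINT h|lborel. S h) / 2) at_top"
    by (intro tendsto_divide tendsto_const) auto
  moreover have "\<forall>\<^sub>F R in at_top. (LINT h|lborel. indicator (?A R) h *\<^sub>R S h) / 2 = truncated_integral s \<epsilon> (u_fun e \<delta>) x R"
    using eventually_gt_at_top[of 0]
  proof eventually_elim
    case (elim R)
    have int: "set_integrable lborel (?A R) ?G"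
      by (rule truncated_integrand_integrable[OF \<delta> s elim])
    have sym: "- h \<in> ?A R \<longleftrightarrow> h \<in> ?A R" for h by simp
    have "(LINT h : ?A R | lborel. S h) = (LINT h : ?A R | lborel. ?G h + ?G (- h))"
      by (simp add: S_def)
    also have "\<dots> = (LINT h : ?A R | lborel. ?G h) + (LINT h : ?A R | lborel. ?G (- h))"
      by (rule set_integral_add(2)[OF int set_integral_reflect(1)[OF meas A sym int]])
    also have "\<dots> = 2 * truncated_integral s \<epsilon> (u_fun e \<delta>) x R"
      unfolding truncated_integral_def by (subst set_integral_reflect(2)[OF meas A sym]) simp
    finally show ?case by (simp add: set_lebesgue_integral_def)
  qed
  ultimately show ?thesis by (rule Lim_transform_eventually)
qed

theorem theorem4p2:
  fixes e :: "'n::finite" and \<epsilon> \<delta> :: real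
  assumes "CARD('n) \<ge> 2"
    and "\<epsilon> \<in> {0..1/2}" and "\<delta> \<in> {0..1/2}"
  shows "AE x :: real ^ 'n in lborel.
    (\<forall>s\<in>{0<..<1}. \<exists>L. (truncated_integral s \<epsilon> (u_fun e \<delta>) x \<longlongrightarrow> L) at_top) \<and>
    ((\<lambda>s. frac_op s \<epsilon> (u_fun e \<delta>) x) \<longlongrightarrow> local_op \<epsilon> (u_fun e \<delta>) x) (at_left 1)"
  using AE_lborel_neq[of "0 :: real ^ 'n"]
proof eventually_elim
  case (elim x)
  let ?u = "u_fun e \<delta>"
  define n where "n = real CARD('n)"
  have n: "n > 0" by (simp add: n_def)
  have \<delta>: "0 \<le> \<delta>" "\<delta> \<le> 1" using assms by auto
  define \<alpha> where "\<alpha> s = 1 - (1 + 2 * s) / 2 * \<epsilon>" for s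
  define \<beta> where "\<beta> s = (n + 2 * s) / 2 * \<epsilon>" for s
  define I0 where "I0 s = (LINT h|lborel. norm h powr (- n - 2 * s) * isotropic_difference e \<delta> x h)" for s
  define I1 where "I1 s = (LINT h|lborel. norm h powr (- n - 2 * s) * radial_difference e \<delta> x h)" for s
  note data0 = isotropic_difference_measurable continuous_isotropic_quad
    isotropic_difference_bound[OF \<delta> elim] isotropic_difference_expand[OF elim]
  note data1 = radial_difference_measurable continuous_radial_quad
    radial_difference_bound[OF \<delta> elim] radial_difference_expand[OF elim]
  have lim: "(truncated_integral s \<epsilon> ?u x \<longlongrightarrow> (\<alpha> s * I0 s + \<beta> s * I1 s) / 2) at_top"
    if s: "s \<in> {0<..<1}" for s
  proof -
    have int: "integrable lborel (\<lambda>h. norm h powr (- n - 2 * s) * isotropic_difference e \<delta> x h)"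
      "integrable lborel (\<lambda>h. norm h powr (- n - 2 * s) * radial_difference e \<delta> x h)"
      unfolding n_def by (rule singular_integrable[OF data0 s] singular_integrable[OF data1 s])+
    have "s > 0" using s by simp
    from truncated_integral_tendsto[OF \<delta> this, where x = x and e = e and \<epsilon> = \<epsilon>]
    have "(truncated_integral s \<epsilon> ?u x \<longlongrightarrow> (LINT h|lborel.
        \<alpha> s * (norm h powr (- n - 2 * s) * isotropic_difference e \<delta> x h)
        + \<beta> s * (norm h powr (- n - 2 * s) * radial_difference e \<delta> x h)) / 2) at_top"
      unfolding kernel_symmetrized \<alpha>_def[symmetric] n_def[symmetric] \<beta>_def[symmetric]
      using int by simp
    then show ?thesis using int by (simp add: I0_def I1_def)
  qed
  have J0: "((\<lambda>s. (1 - s) * I0 s) \<longlongrightarrow> n / 2 * sphere_moment (isotropic_quad e \<delta> x)) (at_left 1)"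
    unfolding I0_def n_def by (rule singular_limit[OF data0])
  have J1: "((\<lambda>s. (1 - s) * I1 s) \<longlongrightarrow> n / 2 * sphere_moment (radial_quad e \<delta> x)) (at_left 1)"
    unfolding I1_def n_def by (rule singular_limit[OF data1])
  \<comment> \<open>The zero of \<open>kappa\<close> and the blow-up of the two integrals are
    balanced by dividing and multiplying by 1 - s.\<close>
  have "((\<lambda>s. kappa CARD('n) s / (1 - s) * (\<alpha> s * ((1 - s) * I0 s) + \<beta> s * ((1 - s) * I1 s))) \<longlongrightarrow>
      2 / unit_ball_vol n * (\<alpha> 1 * (n / 2 * sphere_moment (isotropic_quad e \<delta> x))
        + \<beta> 1 * (n / 2 * sphere_moment (radial_quad e \<delta> x)))) (at_left 1)"
    by (rule tendsto_mult[OF kappa_tendsto[of "CARD('n)", folded n_def]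
        tendsto_add[OF tendsto_mult[OF _ J0] tendsto_mult[OF _ J1]]])
      (auto simp: \<alpha>_def \<beta>_def intro!: tendsto_eq_intros)
  also have "2 / unit_ball_vol n * (\<alpha> 1 * (n / 2 * sphere_moment (isotropic_quad e \<delta> x))
        + \<beta> 1 * (n / 2 * sphere_moment (radial_quad e \<delta> x))) = local_op \<epsilon> ?u x"
  proof -
    define V where "V = unit_ball_vol n"
    have V: "V > 0" using n by (simp add: V_def unit_ball_vol_def Gamma_real_pos)
    define P where "P = norm x powr (- \<delta> - 2) * x $ e"
    have "2 / V * (\<alpha> 1 * (n / 2 * (P * (V / n * \<delta> * (n - \<delta>)))) + \<beta> 1 * (n / 2 * (P * (V / n * q))))
        = P * (\<alpha> 1 * (\<delta> * (n - \<delta>)) + \<beta> 1 * q)" for q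
      using V n by (simp add: field_simps)
    from this[of "3 * \<delta> - 2 - 3 * (\<delta>\<^sup>2 + 2 * \<delta> - 2) / (n + 2)"]
    have "2 / V * (\<alpha> 1 * (n / 2 * (P * (V / n * \<delta> * (n - \<delta>))))
        + \<beta> 1 * (n / 2 * (P * (V / n * (3 * \<delta> - 2 - 3 * (\<delta>\<^sup>2 + 2 * \<delta> - 2) / (n + 2))))))
      = P * (\<alpha> 1 * (\<delta> * (n - \<delta>)) + \<beta> 1 * (3 * \<delta> - 2 - 3 * (\<delta>\<^sup>2 + 2 * \<delta> - 2) / (n + 2)))" .
    \<comment> \<open>The factor n + 2 in the radial coefficient at s = 1 cancels the denominator of
      the fourth moments, and the terms in which eps multiplies delta then cancel.\<close>
    also have "\<alpha> 1 * (\<delta> * (n - \<delta>)) + \<beta> 1 * (3 * \<delta> - 2 - 3 * (\<delta>\<^sup>2 + 2 * \<delta> - 2) / (n + 2))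
      = \<delta> * (n - \<delta>) - \<epsilon> * (n - 1)"
      unfolding \<alpha>_def \<beta>_def using n by (simp add: divide_simps) algebra
    finally show ?thesis
      unfolding local_op_u_fun[OF elim] sphere_moment_isotropic_quad[OF elim] sphere_moment_radial_quad[OF elim]
        n_def[symmetric] V_def P_def .
  qed
  finally have main: "((\<lambda>s. kappa CARD('n) s / (1 - s) * (\<alpha> s * ((1 - s) * I0 s) + \<beta> s * ((1 - s) * I1 s))) \<longlongrightarrow>
      local_op \<epsilon> ?u x) (at_left 1)" .
  have ev: "\<forall>\<^sub>F s in at_left (1::real). s \<in> {0<..<1}"
    using eventually_at_left_real[of 0 1] by simp
  have "((\<lambda>s. frac_op s \<epsilon> ?u x) \<longlongrightarrow> local_op \<epsilon> ?u x) (at_left 1)"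
    using main
  proof (rule Lim_transform_eventually)
    show "\<forall>\<^sub>F s in at_left 1. kappa CARD('n) s / (1 - s) * (\<alpha> s * ((1 - s) * I0 s) + \<beta> s * ((1 - s) * I1 s)) =
        frac_op s \<epsilon> ?u x"
      using ev
    proof eventually_elim
      case (elim s)
      \<comment> \<open>The limit in R has been shown to exist, which determines \<open>Lim\<close>;
        the factor 2 of the operator absorbs the half from symmetrization.\<close>
      have "frac_op s \<epsilon> ?u x = kappa CARD('n) s * (\<alpha> s * I0 s + \<beta> s * I1 s)"
        unfolding frac_op_def tendsto_Lim[OF trivial_limit_at_top_linorder lim[OF elim]] by simp
      then show ?case using elim by (simp add: field_simps)
    qed
  qed
  with lim show ?case by blast
qed

end
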